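(* For every $u_0\in\mathcal M$, define $$u(t):=\frac{S_P(t)u_0}{\|S_P(t)u_0\|_H}=\frac{e^{-t\mathcal A}u_0}{\|e^{-t\mathcal A}u_0\|_H},\qquad t\ge 0 .$$ Then $$u\in C([0,\infty);H)\cap C((0,\infty);\mathcal D(P(\mathcal B)))\cap C^1((0,\infty);H),$$ $u(t)\in\mathcal M$ for all $t\ge0$, $u(0)=u_0$, and $$\partial_t u(t)=-\Pi_{u(t)}P(\mathcal B)u(t)\qquad\text{for every }t>0 .$$ This solution of the initial value problem ($\partial_t u=-\Pi_uP(\mathcal B)u$ for $t>0$, $u(0)=u_0$, $u(t)\in\mathcal M$) is unique in the class $C([0,\infty);H)\cap C((0,\infty);\mathcal D(P(\mathcal B)))\cap C^1((0,\infty);H)$. If $u_0\in\mathcal D(P(\mathcal B))\cap\mathcal M$, then $$u\in C([0,\infty);\mathcal D(P(\mathcal B)))\cap C^1([0,\infty);H),$$ and the equation holds also at $t=0$.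
   Context: Let $d\ge1$, let $\Omega\subset\mathbb R^d$ be a bounded connected domain with $C^\infty$ boundary, and let $H=L^2(\Omega)$ (real) with its usual inner product $\langle\cdot,\cdot\rangle_H$ and norm $\|\cdot\|_H$. Let $\mathcal B=-\Delta_D$ be the positive Dirichlet Laplacian, $\mathcal D(\mathcal B)=H^2(\Omega)\cap H^1_0(\Omega)$, with eigenvalues $0<\lambda_1\le\lambda_2\le\cdots$, $\lambda_j\to\infty$ (repeated according to multiplicity) and orthonormal basis $\{e_j\}_{j\ge1}$ of $H$ with $\mathcal Be_j=\lambda_je_j$. Let $P(s)=a_ms^m+\cdots+a_1s+a_0$ be a real polynomial of degree $m\ge1$ with $a_m>0$. For $u=\sum_ju_je_j$, $u_j=\langle u,e_j\rangle_H$, set $P(\mathcal B)u=\sum_jP(\lambda_j)u_je_j$ on $\mathcal D(P(\mathcal B))=\{u\in H:\sum_j|P(\lambda_j)|^2|u_j|^2<\infty\}$, equipped with the graph norm. Let $S_P(t)=e^{-tP(\mathcal B)}$, i.e. $S_P(t)u=\sum_je^{-tP(\lambda_j)}u_je_j$. Put $\mu_P=\min_{s\ge\lambda_1}P(s)$, fix $\kappa>\max\{0,1-\mu_P\}$ and set $\mathcal A=P(\mathcal B)+\kappa I$, with $e^{-t\mathcal A}u=\sum_je^{-t(P(\lambda_j)+\kappa)}u_je_j$. Let $\mathcal M=\{u\in H:\|u\|_H=1\}$ and, for $u\in\mathcal M$, $\Pi_uv=v-\langle v,u\rangle_Hu$ for $v\in H$. *)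

theory Defs
  imports "HOL-Analysis.Analysis" "HOL-Computational_Algebra.Polynomial"
begin

section \<open>Real square-integrable functions modulo null sets\<close>

definition square_integrable :: "('a::euclidean_space \<Rightarrow> real) \<Rightarrow> bool" where
  "square_integrable f \<longleftrightarrow>
     f \<in> borel_measurable lebesgue \<and> integrable lebesgue (\<lambda>x. (f x)\<^sup>2)"

definition l2rel :: "('a::euclidean_space \<Rightarrow> real) \<Rightarrow> ('a \<Rightarrow> real) \<Rightarrow> bool" where
  "l2rel f g \<longleftrightarrow>
     square_integrable f \<and> square_integrable g \<and> (AE x in lebesgue. f x = g x)"

lemma square_integrable_zero: "square_integrable (\<lambda>x. 0)"
  by (simp add: square_integrable_def)

lemma square_integrable_mult:
  assumes "square_integrable f" "square_integrable g"
  shows "integrable lebesgue (\<lambda>x. f x * g x)"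
proof (rule Bochner_Integration.integrable_bound)
  show "integrable lebesgue (\<lambda>x. (f x)\<^sup>2 + (g x)\<^sup>2)"
    using assms by (simp add: square_integrable_def)
  show "(\<lambda>x. f x * g x) \<in> borel_measurable lebesgue"
    using assms by (auto simp: square_integrable_def intro: borel_measurable_times)
  show "AE x in lebesgue. norm (f x * g x) \<le> norm ((f x)\<^sup>2 + (g x)\<^sup>2)"
  proof (rule AE_I2)
    fix x
    have "2 * (\<bar>f x\<bar> * \<bar>g x\<bar>) \<le> (f x)\<^sup>2 + (g x)\<^sup>2"
      using zero_le_power2[of "\<bar>f x\<bar> - \<bar>g x\<bar>"] by (simp add: power2_diff)
    moreover have "0 \<le> \<bar>f x\<bar> * \<bar>g x\<bar>" by simp
    ultimately have "\<bar>f x\<bar> * \<bar>g x\<bar> \<le> (f x)\<^sup>2 + (g x)\<^sup>2"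
      by linarith
    then show "norm (f x * g x) \<le> norm ((f x)\<^sup>2 + (g x)\<^sup>2)"
      by (simp add: abs_mult)
  qed
qed

lemma square_integrable_scale:
  "square_integrable f \<Longrightarrow> square_integrable (\<lambda>x. c * f x)"
  by (auto simp: square_integrable_def power_mult_distrib)

lemma square_integrable_add:
  assumes "square_integrable f" "square_integrable g"
  shows "square_integrable (\<lambda>x. f x + g x)"
  using assms square_integrable_mult[OF assms]
  by (auto simp: square_integrable_def power2_sum mult.assoc)

lemma square_integrable_uminus:
  "square_integrable f \<Longrightarrow> square_integrable (\<lambda>x. - f x)"
  using square_integrable_scale[of f "-1"] by simp

lemma square_integrable_diff:
  "square_integrable f \<Longrightarrow> square_integrable g \<Longrightarrow> square_integrable (\<lambda>x. f x - g x)"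
  using square_integrable_add[OF _ square_integrable_uminus, of f g] by simp

quotient_type (overloaded) 'a l2 = "'a::euclidean_space \<Rightarrow> real" / partial: l2rel
  morphisms rep_l2 l2_of
proof (rule part_equivpI)
  show "\<exists>f. l2rel f f"
    by (rule exI[of _ "\<lambda>_. 0"]) (simp add: l2rel_def square_integrable_zero)
  show "symp (l2rel :: ('a \<Rightarrow> real) \<Rightarrow> _)"
    by (auto simp: symp_def l2rel_def)
  show "transp (l2rel :: ('a \<Rightarrow> real) \<Rightarrow> _)"
    by (auto simp: transp_def l2rel_def)
qed

instantiation l2 :: (euclidean_space) real_vector
begin

lift_definition zero_l2 :: "'a l2" is "\<lambda>_. 0"
  by (simp add: l2rel_def square_integrable_zero)

lift_definition plus_l2 :: "'a l2 \<Rightarrow> 'a l2 \<Rightarrow> 'a l2" is "\<lambda>f g x. f x + g x"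
  by (auto simp: l2rel_def intro: square_integrable_add)

lift_definition scaleR_l2 :: "real \<Rightarrow> 'a l2 \<Rightarrow> 'a l2" is "\<lambda>c f x. c * f x"
  by (auto simp: l2rel_def intro: square_integrable_scale)

lift_definition uminus_l2 :: "'a l2 \<Rightarrow> 'a l2" is "\<lambda>f x. - f x"
  by (auto simp: l2rel_def intro: square_integrable_uminus)

lift_definition minus_l2 :: "'a l2 \<Rightarrow> 'a l2 \<Rightarrow> 'a l2" is "\<lambda>f g x. f x - g x"
  by (auto simp: l2rel_def intro: square_integrable_diff)

instance
proof
  fix f g h :: "'a l2" and r s :: real
  show "f + g + h = f + (g + h)"
    by transfer (auto simp: l2rel_def add.assoc intro!: square_integrable_add)
  show "f + g = g + f"
    by transfer (auto simp: l2rel_def add.commute intro!: square_integrable_add)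
  show "0 + f = f"
    by transfer (auto simp: l2rel_def)
  show "- f + f = 0"
    by transfer (auto simp: l2rel_def square_integrable_zero)
  show "f - g = f + - g"
    by transfer (auto simp: l2rel_def intro!: square_integrable_diff)
  show "r *\<^sub>R (f + g) = r *\<^sub>R f + r *\<^sub>R g"
    by transfer (auto simp: l2rel_def distrib_left
        intro!: square_integrable_add square_integrable_scale)
  show "(r + s) *\<^sub>R f = r *\<^sub>R f + s *\<^sub>R f"
    by transfer (auto simp: l2rel_def distrib_right
        intro!: square_integrable_add square_integrable_scale)
  show "r *\<^sub>R s *\<^sub>R f = (r * s) *\<^sub>R f"
    by transfer (auto simp: l2rel_def mult.assoc intro!: square_integrable_scale)
  show "1 *\<^sub>R f = f"
    by transfer (auto simp: l2rel_def)
qed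

end

instantiation l2 :: (euclidean_space) real_inner
begin

lift_definition inner_l2 :: "'a l2 \<Rightarrow> 'a l2 \<Rightarrow> real"
  is "\<lambda>f g. integral\<^sup>L lebesgue (\<lambda>x. f x * g x)"
  by (rule integral_cong_AE) (auto simp: l2rel_def square_integrable_def)

definition norm_l2 :: "'a l2 \<Rightarrow> real" where "norm_l2 f = sqrt (f \<bullet> f)"

definition dist_l2 :: "'a l2 \<Rightarrow> 'a l2 \<Rightarrow> real" where "dist_l2 f g = norm (f - g)"

definition sgn_l2 :: "'a l2 \<Rightarrow> 'a l2" where "sgn_l2 f = f /\<^sub>R norm f"

definition uniformity_l2 :: "('a l2 \<times> 'a l2) filter" where
  "uniformity_l2 = (INF e\<in>{0<..}. principal {(f, g). dist f g < e})"

definition open_l2 :: "'a l2 set \<Rightarrow> bool" where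
  "open_l2 U \<longleftrightarrow> (\<forall>f\<in>U. eventually (\<lambda>(f', g). f' = f \<longrightarrow> g \<in> U) uniformity)"

instance
proof
  fix f g h :: "'a l2" and r :: real and U :: "'a l2 set"
  show "dist f g = norm (f - g)" by (rule dist_l2_def)
  show "sgn f = f /\<^sub>R norm f" by (rule sgn_l2_def)
  show "uniformity = (INF e\<in>{0<..}. principal {(f, g :: 'a l2). dist f g < e})"
    by (rule uniformity_l2_def)
  show "open U \<longleftrightarrow> (\<forall>f\<in>U. eventually (\<lambda>(f', g). f' = f \<longrightarrow> g \<in> U) uniformity)"
    by (rule open_l2_def)
  show "f \<bullet> g = g \<bullet> f"
    by transfer (simp add: mult.commute)
  show "(f + g) \<bullet> h = f \<bullet> h + g \<bullet> h"
    by transfer (auto simp: l2rel_def distrib_right square_integrable_mult)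
  show "(r *\<^sub>R f) \<bullet> g = r * (f \<bullet> g)"
    by transfer (auto simp: l2rel_def mult.assoc)
  show "0 \<le> f \<bullet> f"
    by transfer (auto intro!: integral_nonneg_AE)
  show "f \<bullet> f = 0 \<longleftrightarrow> f = 0"
  proof transfer
    fix f :: "'a \<Rightarrow> real" assume f: "l2rel f f"
    then have "integrable lebesgue (\<lambda>x. f x * f x)"
      by (auto simp: l2rel_def square_integrable_mult)
    from integral_nonneg_eq_0_iff_AE[OF this]
    have "integral\<^sup>L lebesgue (\<lambda>x. f x * f x) = 0 \<longleftrightarrow> (AE x in lebesgue. f x = 0)"
      by simp
    with f show "integral\<^sup>L lebesgue (\<lambda>x. f x * f x) = 0 \<longleftrightarrow> l2rel f (\<lambda>_. 0)"
      by (auto simp: l2rel_def square_integrable_zero)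
  qed
  show "norm f = sqrt (f \<bullet> f)" by (rule norm_l2_def)
qed

end

text \<open>\<open>L\<^sup>2(\<Omega>)\<close> is identified, via extension by zero, with the closed subspace of
  \<open>L\<^sup>2\<close> of the whole space consisting of the classes that vanish almost everywhere outside
  \<open>\<Omega>\<close>. The inner product and norm are the ones inherited from the ambient space.\<close>

definition L2 :: "'a::euclidean_space set \<Rightarrow> 'a l2 set" where
  "L2 \<Omega> = {f. AE x in lebesgue. x \<notin> \<Omega> \<longrightarrow> rep_l2 f x = 0}"


section \<open>Smooth functions and smoothly bounded domains\<close>

definition partial :: "'a::euclidean_space \<Rightarrow> ('a \<Rightarrow> real) \<Rightarrow> 'a \<Rightarrow> real" where
  "partial b f x = frechet_derivative f (at x) b"

primrec Ck :: "nat \<Rightarrow> ('a::euclidean_space \<Rightarrow> real) \<Rightarrow> bool" where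
  "Ck 0 f \<longleftrightarrow> continuous_on UNIV f"
| "Ck (Suc k) f \<longleftrightarrow> f differentiable_on UNIV \<and> (\<forall>b\<in>Basis. Ck k (partial b f))"

definition smooth :: "('a::euclidean_space \<Rightarrow> real) \<Rightarrow> bool" where
  "smooth f \<longleftrightarrow> (\<forall>k. Ck k f)"

text \<open>Near each boundary point, after relabelling and reorienting the coordinate axes,
  \<open>\<Omega>\<close> is the region above the graph of a smooth function of the remaining coordinates.
  Here \<open>b\<close> is the signed axis of the graph direction and \<open>x - (x \<bullet> b) *\<^sub>R b\<close> is \<open>x\<close> with that
  coordinate removed.\<close>

definition smooth_boundary :: "'a::euclidean_space set \<Rightarrow> bool" where
  "smooth_boundary \<Omega> \<longleftrightarrow>
     (\<forall>x0\<in>frontier \<Omega>. \<exists>r>0. \<exists>b\<in>Basis \<union> uminus ` Basis. \<exists>\<gamma>. smooth \<gamma> \<and>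
        \<Omega> \<inter> ball x0 r = {x \<in> ball x0 r. \<gamma> (x - (x \<bullet> b) *\<^sub>R b) < x \<bullet> b})"

definition smooth_bounded_domain :: "'a::euclidean_space set \<Rightarrow> bool" where
  "smooth_bounded_domain \<Omega> \<longleftrightarrow>
     open \<Omega> \<and> connected \<Omega> \<and> \<Omega> \<noteq> {} \<and> bounded \<Omega> \<and> smooth_boundary \<Omega>"


section \<open>Sobolev spaces and the Dirichlet Laplacian\<close>

definition test_functions :: "'a::euclidean_space set \<Rightarrow> ('a \<Rightarrow> real) set" where
  "test_functions \<Omega> =
     {\<phi>. smooth \<phi> \<and> compact (closure {x. \<phi> x \<noteq> 0}) \<and> closure {x. \<phi> x \<noteq> 0} \<subseteq> \<Omega>}"

text \<open>The inner products below are the integrals of \<open>f \<cdot> \<partial>\<^sub>b \<phi>\<close> and \<open>g \<cdot> \<phi>\<close>.\<close>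

definition weak_partial :: "'a::euclidean_space set \<Rightarrow> 'a \<Rightarrow> 'a l2 \<Rightarrow> 'a l2 \<Rightarrow> bool" where
  "weak_partial \<Omega> b f g \<longleftrightarrow> f \<in> L2 \<Omega> \<and> g \<in> L2 \<Omega> \<and>
     (\<forall>\<phi>\<in>test_functions \<Omega>. f \<bullet> l2_of (partial b \<phi>) = - (g \<bullet> l2_of \<phi>))"

definition H1 :: "'a::euclidean_space set \<Rightarrow> 'a l2 set" where
  "H1 \<Omega> = {f \<in> L2 \<Omega>. \<forall>b\<in>Basis. \<exists>g. weak_partial \<Omega> b f g}"

definition H2 :: "'a::euclidean_space set \<Rightarrow> 'a l2 set" where
  "H2 \<Omega> = {f \<in> H1 \<Omega>. \<forall>b\<in>Basis. \<exists>g\<in>H1 \<Omega>. weak_partial \<Omega> b f g}"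

text \<open>The closure of the test functions with respect to the \<open>H\<^sup>1\<close> norm.\<close>

definition H1_0 :: "'a::euclidean_space set \<Rightarrow> 'a l2 set" where
  "H1_0 \<Omega> = {f \<in> H1 \<Omega>. \<exists>\<phi> :: nat \<Rightarrow> 'a \<Rightarrow> real.
     (\<forall>n. \<phi> n \<in> test_functions \<Omega>) \<and> (\<lambda>n. l2_of (\<phi> n)) \<longlonglongrightarrow> f \<and>
     (\<forall>b\<in>Basis. \<exists>g. weak_partial \<Omega> b f g \<and> (\<lambda>n. l2_of (partial b (\<phi> n))) \<longlonglongrightarrow> g)}"

text \<open>The graph of \<open>-\<Delta>\<^sub>D\<close>: \<open>f\<close> is in the domain \<open>H\<^sup>2(\<Omega>) \<inter> H\<^sup>1\<^sub>0(\<Omega>)\<close> and \<open>w = -\<Delta> f\<close>.\<close>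

definition dirichlet_laplacian :: "'a::euclidean_space set \<Rightarrow> 'a l2 \<Rightarrow> 'a l2 \<Rightarrow> bool" where
  "dirichlet_laplacian \<Omega> f w \<longleftrightarrow> f \<in> H2 \<Omega> \<inter> H1_0 \<Omega> \<and>
     (\<exists>g h. (\<forall>b\<in>Basis. weak_partial \<Omega> b f (g b) \<and> weak_partial \<Omega> b (g b) (h b)) \<and>
            w = - (\<Sum>b\<in>Basis. h b))"

text \<open>Indices start at 0, so \<open>lam 0\<close> is the lowest eigenvalue \<open>\<lambda>\<^sub>1\<close>. Monotonicity of \<open>lam\<close>
  together with \<open>e\<close> being an orthonormal basis means that eigenvalues are listed in increasing
  order and repeated according to multiplicity.\<close>

definition dirichlet_eigenbasis ::
  "'a::euclidean_space set \<Rightarrow> (nat \<Rightarrow> real) \<Rightarrow> (nat \<Rightarrow> 'a l2) \<Rightarrow> bool" where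
  "dirichlet_eigenbasis \<Omega> lam e \<longleftrightarrow>
     0 < lam 0 \<and> mono lam \<and> filterlim lam at_top sequentially \<and>
     (\<forall>i j. e i \<bullet> e j = (if i = j then 1 else 0)) \<and>
     closure (span (range e)) = L2 \<Omega> \<and>
     (\<forall>j. dirichlet_laplacian \<Omega> (e j) (lam j *\<^sub>R e j))"


section \<open>Functional calculus and function classes\<close>

definition spectral ::
  "(nat \<Rightarrow> real) \<Rightarrow> (nat \<Rightarrow> 'a::euclidean_space l2) \<Rightarrow> (real \<Rightarrow> real) \<Rightarrow> 'a l2 \<Rightarrow> 'a l2" where
  "spectral lam e F u = (\<Sum>j. (F (lam j) * (u \<bullet> e j)) *\<^sub>R e j)"

definition PB ::
  "(nat \<Rightarrow> real) \<Rightarrow> (nat \<Rightarrow> 'a::euclidean_space l2) \<Rightarrow> real poly \<Rightarrow> 'a l2 \<Rightarrow> 'a l2" where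
  "PB lam e P = spectral lam e (poly P)"

definition dom_PB ::
  "'a::euclidean_space set \<Rightarrow> (nat \<Rightarrow> real) \<Rightarrow> (nat \<Rightarrow> 'a l2) \<Rightarrow> real poly \<Rightarrow> 'a l2 set" where
  "dom_PB \<Omega> lam e P =
     {u \<in> L2 \<Omega>. summable (\<lambda>j. \<bar>poly P (lam j)\<bar>\<^sup>2 * \<bar>u \<bullet> e j\<bar>\<^sup>2)}"

definition graph_norm ::
  "(nat \<Rightarrow> real) \<Rightarrow> (nat \<Rightarrow> 'a::euclidean_space l2) \<Rightarrow> real poly \<Rightarrow> 'a l2 \<Rightarrow> real" where
  "graph_norm lam e P u = sqrt ((norm u)\<^sup>2 + (norm (PB lam e P u))\<^sup>2)"

definition S_P ::
  "(nat \<Rightarrow> real) \<Rightarrow> (nat \<Rightarrow> 'a::euclidean_space l2) \<Rightarrow> real poly \<Rightarrow> real \<Rightarrow> 'a l2 \<Rightarrow> 'a l2" where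
  "S_P lam e P t = spectral lam e (\<lambda>s. exp (- t * poly P s))"

definition exp_A ::
  "(nat \<Rightarrow> real) \<Rightarrow> (nat \<Rightarrow> 'a::euclidean_space l2) \<Rightarrow> real poly \<Rightarrow> real \<Rightarrow> real \<Rightarrow> 'a l2 \<Rightarrow> 'a l2"
  where "exp_A lam e P \<kappa> t = spectral lam e (\<lambda>s. exp (- t * (poly P s + \<kappa>)))"

text \<open>The minimum exists for polynomials of positive degree with positive leading coefficient.\<close>

definition mu_P :: "(nat \<Rightarrow> real) \<Rightarrow> real poly \<Rightarrow> real" where
  "mu_P lam P = (LEAST m. m \<in> poly P ` {lam 0..})"

definition unit_sphere :: "'a::euclidean_space set \<Rightarrow> 'a l2 set" where
  "unit_sphere \<Omega> = {u \<in> L2 \<Omega>. norm u = 1}"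

definition tproj :: "'a::real_inner \<Rightarrow> 'a \<Rightarrow> 'a" where
  "tproj u v = v - (v \<bullet> u) *\<^sub>R u"

text \<open>Curves are total functions; the classes only constrain them on the interval \<open>I\<close>.\<close>

definition C_H :: "real set \<Rightarrow> 'a::euclidean_space set \<Rightarrow> (real \<Rightarrow> 'a l2) set" where
  "C_H I \<Omega> = {u. u ` I \<subseteq> L2 \<Omega> \<and> continuous_on I u}"

definition C1_H :: "real set \<Rightarrow> 'a::euclidean_space set \<Rightarrow> (real \<Rightarrow> 'a l2) set" where
  "C1_H I \<Omega> = {u. u ` I \<subseteq> L2 \<Omega> \<and>
     (\<exists>u'. (\<forall>t\<in>I. (u has_vector_derivative u' t) (at t within I)) \<and> u' \<in> C_H I \<Omega>)}"

definition C_dom :: "real set \<Rightarrow> 'a::euclidean_space set \<Rightarrow> (nat \<Rightarrow> real) \<Rightarrow> (nat \<Rightarrow> 'a l2) \<Rightarrow>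
    real poly \<Rightarrow> (real \<Rightarrow> 'a l2) set" where
  "C_dom I \<Omega> lam e P = {u. u ` I \<subseteq> dom_PB \<Omega> lam e P \<and>
     (\<forall>t\<in>I. ((\<lambda>s. graph_norm lam e P (u s - u t)) \<longlongrightarrow> 0) (at t within I))}"

definition solves_flow :: "'a::euclidean_space set \<Rightarrow> (nat \<Rightarrow> real) \<Rightarrow> (nat \<Rightarrow> 'a l2) \<Rightarrow>
    real poly \<Rightarrow> 'a l2 \<Rightarrow> (real \<Rightarrow> 'a l2) \<Rightarrow> bool" where
  "solves_flow \<Omega> lam e P u0 u \<longleftrightarrow>
     (\<forall>t\<ge>0. u t \<in> unit_sphere \<Omega>) \<and> u 0 = u0 \<and>
     (\<forall>t>0. (u has_vector_derivative - tproj (u t) (PB lam e P (u t))) (at t))"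

end

theory Submission
  imports Defs
begin

text \<open>
  In the eigenbasis the semigroup multiplies the \<open>j\<close>-th coefficient by \<open>exp (- t * p j)\<close> with
  \<open>p j = poly P (lam j)\<close>, and the sequence \<open>p\<close> is bounded below because \<open>P\<close> is bounded below on the
  positive half-line. The whole theorem is a statement about such diagonal semigroups in a Hilbert
  space.

  Existence and regularity. The linear orbit \<open>y t = semi t u0\<close> is continuous on \<open>[0, \<infinity>)\<close>,
  is differentiable with \<open>y' = - gen y\<close> as soon as it lies in the domain
  (\<open>semi_has_derivative\<close>), and lies in the domain for every \<open>t > 0\<close> because \<open>s * exp (- t * s)\<close> is
  bounded for \<open>s\<close> bounded below (\<open>semi_smoothing\<close>). It never vanishes, so it can be
  normalized. Differentiating \<open>y / \<parallel>y\<parallel>\<close> removes the radial component of \<open>y'\<close>, which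
  turns the linear equation into the projected one (\<open>has_vector_derivative_normalize\<close>, \<open>flow_regular\<close>).

  Uniqueness. Along a solution \<open>v\<close> of the projected equation every coefficient satisfies
  \<open>v\<^sub>j' = (\<alpha> - p j) v\<^sub>j\<close> with a scalar function \<open>\<alpha>\<close> that does not depend on \<open>j\<close>. So, up to a
  positive scalar, \<open>v\<close> solves the linear equation, and since its norm is \<open>1\<close> it is the normalized
  linear orbit (\<open>flow_unique\<close>).

  All of this presupposes that the series defining the functional calculus converge, which rests on
  the completeness of \<open>L\<^sup>2\<close>.
\<close>

section \<open>Completeness of the space of square-integrable functions\<close>

lemma l2rel_refl_iff: "l2rel f f \<longleftrightarrow> square_integrable f"
  by (auto simp: l2rel_def)

lemma l2_of_rep_l2: "l2_of (rep_l2 x) = x"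
  by (rule Quotient3_abs_rep[OF Quotient3_l2])

lemma square_integrable_rep_l2: "square_integrable (rep_l2 x)"
  using Quotient3_rep_reflp[OF Quotient3_l2] by (simp add: l2rel_refl_iff)

lemma inner_l2_of:
  "square_integrable f \<Longrightarrow> square_integrable g \<Longrightarrow>
    l2_of f \<bullet> l2_of g = (LINT x|lebesgue. f x * g x)"
  by (rule inner_l2.abs_eq) (auto simp: l2rel_refl_iff)

lemma l2_of_diff:
  "square_integrable f \<Longrightarrow> square_integrable g \<Longrightarrow> l2_of f - l2_of g = l2_of (\<lambda>x. f x - g x)"
  by (rule minus_l2.abs_eq) (auto simp: l2rel_refl_iff)

lemma l2_of_diff_rep_l2: "l2_of (\<lambda>t. rep_l2 x t - rep_l2 y t) = x - y"
  by (metis l2_of_diff l2_of_rep_l2 square_integrable_rep_l2)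

lemma l2_of_minus_rep_l2: "square_integrable f \<Longrightarrow> l2_of (\<lambda>t. f t - rep_l2 y t) = l2_of f - y"
  by (metis l2_of_diff l2_of_rep_l2 square_integrable_rep_l2)

lemma norm_l2_of_squared:
  "square_integrable f \<Longrightarrow> (norm (l2_of f))\<^sup>2 = (LINT x|lebesgue. (f x)\<^sup>2)"
  by (simp add: power2_norm_eq_inner inner_l2_of flip: power2_eq_square)

lemma square_integrable_abs: "square_integrable f \<Longrightarrow> square_integrable (\<lambda>x. \<bar>f x\<bar>)"
  by (auto simp: square_integrable_def)

text \<open>Multiplying by a fixed square-integrable weight carries \<open>L\<^sup>2\<close> boundedly into \<open>L\<^sup>1\<close>. So a
  Cauchy sequence in \<open>L\<^sup>2\<close> becomes one in \<open>L\<^sup>1\<close>, where almost everywhere convergent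
  subsequences come from \<open>cauchy_L1_AE_cauchy_subseq\<close>.\<close>

lemma weighted_L1_le_l2:
  assumes "square_integrable f" "square_integrable w" "\<And>x. 0 \<le> w x"
  shows "(LINT x|lebesgue. \<bar>f x * w x\<bar>) \<le> norm (l2_of f) * norm (l2_of w)"
proof -
  have "(LINT x|lebesgue. \<bar>f x * w x\<bar>) = l2_of (\<lambda>x. \<bar>f x\<bar>) \<bullet> l2_of w"
    using assms by (simp add: inner_l2_of square_integrable_abs abs_mult)
  also have "\<dots> \<le> norm (l2_of (\<lambda>x. \<bar>f x\<bar>)) * norm (l2_of w)"
    by (rule norm_cauchy_schwarz)
  also have "norm (l2_of (\<lambda>x. \<bar>f x\<bar>)) = norm (l2_of f)"
    by (rule power2_eq_imp_eq) (simp_all add: norm_l2_of_squared square_integrable_abs assms(1))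
  finally show ?thesis .
qed

text \<open>The weight has to be positive everywhere, so that pointwise convergence of the weighted functions
  can be divided out again. An integrable function with values in \<open>(0, 1]\<close> will do, since it
  dominates its square.\<close>

lemma positive_square_integrable_exists:
  obtains w :: "'a::euclidean_space \<Rightarrow> real" where "square_integrable w" "\<And>x. 0 < w x"
proof -
  obtain w :: "'a \<Rightarrow> real" where w: "w \<in> borel_measurable lborel" "\<And>x. w x > 0"
      "\<And>x. w x \<le> 1" "integrable lborel w"
    using sigma_finite_measure.obtain_positive_integrable_function[OF sigma_finite_lborel] by blast
  then have w': "w \<in> borel_measurable lebesgue" "integrable lebesgue w"
    by (simp_all add: measurable_completion integrable_completion)
  have "integrable lebesgue (\<lambda>x. (w x)\<^sup>2)"
  proof (rule Bochner_Integration.integrable_bound[OF w'(2)])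
    show "AE x in lebesgue. norm ((w x)\<^sup>2) \<le> norm (w x)"
      using w(2,3) by (auto simp: power2_eq_square less_imp_le intro!: AE_I2 mult_left_le)
  qed (use w'(1) in simp)
  with w(2) w' that show ?thesis by (auto simp: square_integrable_def)
qed

lemma Cauchy_l2_pointwise_subsequence:
  fixes X :: "nat \<Rightarrow> 'a::euclidean_space l2"
  assumes "Cauchy X"
  obtains r f where "strict_mono r" "f \<in> borel_measurable lebesgue"
    "AE x in lebesgue. (\<lambda>i. rep_l2 (X (r i)) x) \<longlonglongrightarrow> f x"
proof -
  obtain w :: "'a \<Rightarrow> real" where w: "square_integrable w" "\<And>x. 0 < w x"
    using positive_square_integrable_exists by blast
  define s where "s = (\<lambda>n. rep_l2 (X n))"
  have s: "square_integrable (s n)" for n by (simp add: s_def square_integrable_rep_l2)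
  have "integrable lebesgue (\<lambda>x. s n x * w x)" for n
    by (rule square_integrable_mult[OF s w(1)])
  moreover have "\<exists>N. \<forall>i\<ge>N. \<forall>j\<ge>N. (LINT x|lebesgue. norm (s i x * w x - s j x * w x)) < \<epsilon>"
    if "0 < \<epsilon>" for \<epsilon>
  proof -
    define C where "C = norm (l2_of w) + 1"
    have "C > 0" by (simp add: C_def add_nonneg_pos)
    then obtain N where N: "\<And>i j. i \<ge> N \<Longrightarrow> j \<ge> N \<Longrightarrow> norm (X i - X j) < \<epsilon> / C"
      using assms \<open>0 < \<epsilon>\<close> by (metis CauchyD divide_pos_pos)
    have "(LINT x|lebesgue. norm (s i x * w x - s j x * w x)) < \<epsilon>" if "i \<ge> N" "j \<ge> N" for i j
    proof -
      have "(LINT x|lebesgue. norm (s i x * w x - s j x * w x))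
          = (LINT x|lebesgue. \<bar>(s i x - s j x) * w x\<bar>)" by (simp add: left_diff_distrib)
      also have "\<dots> \<le> norm (l2_of (\<lambda>x. s i x - s j x)) * norm (l2_of w)"
        by (intro weighted_L1_le_l2 square_integrable_diff s w less_imp_le)
      also have "l2_of (\<lambda>x. s i x - s j x) = X i - X j"
        by (simp add: s_def l2_of_diff_rep_l2)
      also have "norm (X i - X j) * norm (l2_of w) \<le> norm (X i - X j) * C"
        by (intro mult_left_mono) (auto simp: C_def)
      also have "\<dots> < \<epsilon>" using N[OF that] \<open>C > 0\<close> by (simp add: field_simps)
      finally show ?thesis .
    qed
    then show ?thesis by blast
  qed
  ultimately obtain r where r: "strict_mono r" "AE x in lebesgue. Cauchy (\<lambda>i. s (r i) x * w x)"
    by (rule cauchy_L1_AE_cauchy_subseq)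
  have "AE x in lebesgue. (\<lambda>i. s (r i) x) \<longlonglongrightarrow> lim (\<lambda>i. s (r i) x)"
    using r(2)
  proof eventually_elim
    case (elim x)
    then have "convergent (\<lambda>i. s (r i) x * w x)" by (simp add: Cauchy_convergent_iff)
    then have "convergent (\<lambda>i. s (r i) x * w x * inverse (w x))"
      by (auto intro: convergent_mult convergent_const)
    then have "convergent (\<lambda>i. s (r i) x)" using w(2)[of x] by (simp add: mult.assoc)
    then show ?case by (simp add: convergent_LIMSEQ_iff)
  qed
  moreover have "(\<lambda>x. lim (\<lambda>i. s (r i) x)) \<in> borel_measurable lebesgue"
    using s by (intro borel_measurable_lim_metric) (simp add: square_integrable_def)
  ultimately show ?thesis using that r(1) by (auto simp: s_def)
qed

text \<open>Riesz-Fischer. The pointwise limit of a subsequence is the candidate limit; Fatou's lemma bounds its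
  distance from each \<open>X n\<close> by the eventual oscillation of the sequence. This instance is what makes
  the series in the functional calculus converge: a divergent \<open>suminf\<close> would be an
  arbitrary value.\<close>

instance l2 :: (euclidean_space) banach
proof
  fix X :: "nat \<Rightarrow> 'a l2" assume X: "Cauchy X"
  obtain r f where r: "strict_mono r" and f: "f \<in> borel_measurable lebesgue"
    and lim: "AE x in lebesgue. (\<lambda>i. rep_l2 (X (r i)) x) \<longlonglongrightarrow> f x"
    by (rule Cauchy_l2_pointwise_subsequence[OF X])
  define s where "s = (\<lambda>n. rep_l2 (X n))"
  have s: "square_integrable (s n)" for n by (simp add: s_def square_integrable_rep_l2)
  have sm [measurable]: "s n \<in> borel_measurable lebesgue" for n
    using s[of n] by (simp add: square_integrable_def)
  note f [measurable]
  have dist_X: "(norm (X i - X j))\<^sup>2 = (LINT x|lebesgue. (s i x - s j x)\<^sup>2)" for i j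
    using norm_l2_of_squared[OF square_integrable_diff[OF s s], of i j]
    by (simp add: s_def l2_of_diff_rep_l2)
  have dist_f: "(\<integral>\<^sup>+x. ennreal ((f x - s n x)\<^sup>2) \<partial>lebesgue) \<le> ennreal (\<epsilon>\<^sup>2)"
    if N: "\<And>i j. i \<ge> N \<Longrightarrow> j \<ge> N \<Longrightarrow> norm (X i - X j) < \<epsilon>" and n: "n \<ge> N" for N n \<epsilon>
  proof -
    have "(\<integral>\<^sup>+x. ennreal ((f x - s n x)\<^sup>2) \<partial>lebesgue)
        = (\<integral>\<^sup>+x. liminf (\<lambda>i. ennreal ((s (r i) x - s n x)\<^sup>2)) \<partial>lebesgue)"
    proof (rule nn_integral_cong_AE)
      show "AE x in lebesgue. ennreal ((f x - s n x)\<^sup>2)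
          = liminf (\<lambda>i. ennreal ((s (r i) x - s n x)\<^sup>2))"
        using lim
      proof eventually_elim
        case (elim x)
        then have "(\<lambda>i. ennreal ((s (r i) x - s n x)\<^sup>2)) \<longlonglongrightarrow> ennreal ((f x - s n x)\<^sup>2)"
          by (auto simp: s_def intro!: tendsto_intros)
        then show ?case by (rule lim_imp_Liminf[OF sequentially_bot, symmetric])
      qed
    qed
    also have "\<dots> \<le> liminf (\<lambda>i. \<integral>\<^sup>+x. ennreal ((s (r i) x - s n x)\<^sup>2) \<partial>lebesgue)"
      by (rule nn_integral_liminf) measurable
    also have "\<dots> \<le> ennreal (\<epsilon>\<^sup>2)"
    proof (rule Liminf_le)
      show "\<forall>\<^sub>F i in sequentially. (\<integral>\<^sup>+x. ennreal ((s (r i) x - s n x)\<^sup>2) \<partial>lebesgue) \<le> ennreal (\<epsilon>\<^sup>2)"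
        using eventually_ge_at_top[of N]
      proof eventually_elim
        case (elim i)
        then have "r i \<ge> N" using seq_suble[OF r, of i] by simp
        have "(\<integral>\<^sup>+x. ennreal ((s (r i) x - s n x)\<^sup>2) \<partial>lebesgue) = ennreal ((norm (X (r i) - X n))\<^sup>2)"
          unfolding dist_X using square_integrable_diff[OF s s]
          by (intro nn_integral_eq_integral) (auto simp: square_integrable_def)
        also have "\<dots> \<le> ennreal (\<epsilon>\<^sup>2)"
          using N[OF \<open>r i \<ge> N\<close> n] by (intro ennreal_leI power_mono) auto
        finally show ?case .
      qed
    qed simp
    finally show ?thesis .
  qed
  have diff_sq: "square_integrable (\<lambda>x. f x - s n x)"
    if "\<And>i j. i \<ge> N \<Longrightarrow> j \<ge> N \<Longrightarrow> norm (X i - X j) < \<epsilon>" "n \<ge> N" for N n \<epsilon>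
    using dist_f[OF that] f sm
    by (auto simp: square_integrable_def integrable_iff_bounded intro: le_less_trans)
  obtain N0 where N0: "\<And>i j. i \<ge> N0 \<Longrightarrow> j \<ge> N0 \<Longrightarrow> norm (X i - X j) < 1"
    using CauchyD[OF X, of 1] by auto
  have fsq: "square_integrable f"
    using square_integrable_add[OF diff_sq[OF N0, of N0 N0, OF _ _ order_refl] s[of N0]] by simp
  have "X \<longlonglongrightarrow> l2_of f"
  proof (rule LIMSEQ_I)
    fix \<epsilon> :: real assume \<epsilon>: "0 < \<epsilon>"
    obtain N where N: "\<And>i j. i \<ge> N \<Longrightarrow> j \<ge> N \<Longrightarrow> norm (X i - X j) < \<epsilon> / 2"
      using CauchyD[OF X, of "\<epsilon> / 2"] \<epsilon> by auto
    have "norm (X n - l2_of f) < \<epsilon>" if n: "n \<ge> N" for n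
    proof -
      have "ennreal ((norm (l2_of f - X n))\<^sup>2) = (\<integral>\<^sup>+x. ennreal ((f x - s n x)\<^sup>2) \<partial>lebesgue)"
        using norm_l2_of_squared[OF diff_sq[OF N n]] diff_sq[OF N n]
        by (subst nn_integral_eq_integral)
           (auto simp: square_integrable_def l2_of_minus_rep_l2[OF fsq] s_def)
      also have "\<dots> \<le> ennreal ((\<epsilon> / 2)\<^sup>2)" by (rule dist_f[OF N n])
      finally have "norm (l2_of f - X n) \<le> \<epsilon> / 2"
        using \<epsilon> by (auto simp: power2_le_iff_abs_le)
      then show ?thesis using \<epsilon> by (simp add: norm_minus_commute)
    qed
    then show "\<exists>N. \<forall>n\<ge>N. norm (X n - l2_of f) < \<epsilon>" by blast
  qed
  then show "convergent X" by (auto simp: convergent_def)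
qed

section \<open>Expansions in an orthonormal sequence\<close>

locale orthonormal_sequence =
  fixes e :: "nat \<Rightarrow> 'h::{real_inner, banach}"
  assumes orthonormal: "e i \<bullet> e j = (if i = j then 1 else 0)"
begin

text \<open>In the application this is \<open>L\<^sup>2(\<Omega>)\<close>, a proper closed subspace of the ambient space.\<close>

definition closed_hull :: "'h set" where
  "closed_hull = closure (span (range e))"

definition synth :: "(nat \<Rightarrow> real) \<Rightarrow> 'h" where
  "synth c = (\<Sum>j. c j *\<^sub>R e j)"

lemma norm_sum_squared:
  assumes "finite F"
  shows "(norm (\<Sum>j\<in>F. c j *\<^sub>R e j))\<^sup>2 = (\<Sum>j\<in>F. (c j)\<^sup>2)"
proof -
  have "(norm (\<Sum>j\<in>F. c j *\<^sub>R e j))\<^sup>2 = (\<Sum>i\<in>F. c i * (\<Sum>j\<in>F. c j * (if j = i then 1 else 0)))"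
    by (simp add: power2_norm_eq_inner inner_sum_left inner_sum_right orthonormal mult.left_commute sum_distrib_left)
  also have "\<dots> = (\<Sum>i\<in>F. (c i)\<^sup>2)"
    using assms
    by (intro sum.cong) (simp_all add: power2_eq_square if_distrib[of "\<lambda>x. _ * x"] cong: if_cong)
  finally show ?thesis .
qed

lemma norm_block_le:
  assumes "\<And>j. \<bar>a j\<bar> \<le> K * \<bar>c j\<bar>" "norm (\<Sum>j\<in>{m..<n}. (c j)\<^sup>2) < (\<epsilon> / K)\<^sup>2" "0 < K" "0 < \<epsilon>"
  shows "norm (\<Sum>j\<in>{m..<n}. a j *\<^sub>R e j) \<le> \<epsilon>"
proof -
  have "(norm (\<Sum>j\<in>{m..<n}. a j *\<^sub>R e j))\<^sup>2 = (\<Sum>j\<in>{m..<n}. (a j)\<^sup>2)"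
    by (simp add: norm_sum_squared)
  also have "\<dots> \<le> (\<Sum>j\<in>{m..<n}. K\<^sup>2 * (c j)\<^sup>2)"
    using power_mono[OF assms(1) abs_ge_zero, of _ 2]
    by (intro sum_mono) (simp add: power_mult_distrib)
  also have "\<dots> = K\<^sup>2 * (\<Sum>j\<in>{m..<n}. (c j)\<^sup>2)" by (simp add: sum_distrib_left)
  also have "\<dots> \<le> K\<^sup>2 * (\<epsilon> / K)\<^sup>2"
    using assms(2) by (intro mult_left_mono) auto
  also have "\<dots> = \<epsilon>\<^sup>2" using \<open>0 < K\<close> by (simp add: power_divide)
  finally show ?thesis using \<open>0 < \<epsilon>\<close> by (simp add: power2_le_iff_abs_le)
qed

lemma synth_sums:
  assumes "summable (\<lambda>j. (c j)\<^sup>2)"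
  shows "(\<lambda>j. c j *\<^sub>R e j) sums synth c"
  unfolding synth_def
proof (rule summable_sums, unfold summable_Cauchy, intro allI impI)
  fix \<epsilon> :: real assume "0 < \<epsilon>"
  then have "0 < (\<epsilon> / 2 / 1)\<^sup>2" by simp
  then obtain N where "\<And>m n. m \<ge> N \<Longrightarrow> norm (\<Sum>j\<in>{m..<n}. (c j)\<^sup>2) < (\<epsilon> / 2 / 1)\<^sup>2"
    using assms unfolding summable_Cauchy by blast
  then have "norm (\<Sum>j\<in>{m..<n}. c j *\<^sub>R e j) \<le> \<epsilon> / 2" if "m \<ge> N" for m n
    using that \<open>0 < \<epsilon>\<close> by (intro norm_block_le[where K = 1 and c = c]) auto
  moreover have "\<epsilon> / 2 < \<epsilon>" using \<open>0 < \<epsilon>\<close> by simp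
  ultimately show "\<exists>N. \<forall>m\<ge>N. \<forall>n. norm (\<Sum>j\<in>{m..<n}. c j *\<^sub>R e j) < \<epsilon>"
    by (meson le_less_trans)
qed

text \<open>A Weierstrass test in \<open>\<ell>\<^sup>2\<close>: a square-summable majorant of the coefficients controls all
  tails at once, because the norm of a block is the \<open>\<ell>\<^sup>2\<close> norm of its coefficients. Continuity and
  differentiability of the orbits in time both come from this lemma.\<close>

lemma uniform_limit_synth:
  assumes bound: "\<And>t j. t \<in> S \<Longrightarrow> \<bar>a t j\<bar> \<le> K * \<bar>c j\<bar>" and c: "summable (\<lambda>j. (c j)\<^sup>2)"
    and "0 < K"
  shows "uniform_limit S (\<lambda>n t. \<Sum>j<n. a t j *\<^sub>R e j) (\<lambda>t. synth (a t)) sequentially"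
proof (rule uniform_limitI)
  fix \<epsilon> :: real assume "0 < \<epsilon>"
  then have "0 < (\<epsilon> / 2 / K)\<^sup>2" using \<open>0 < K\<close> by simp
  then obtain N where N: "\<And>m n. m \<ge> N \<Longrightarrow> norm (\<Sum>j\<in>{m..<n}. (c j)\<^sup>2) < (\<epsilon> / 2 / K)\<^sup>2"
    using c unfolding summable_Cauchy by blast
  have "dist (\<Sum>j<n. a t j *\<^sub>R e j) (synth (a t)) < \<epsilon>" if "n \<ge> N" "t \<in> S" for n t
  proof -
    have "summable (\<lambda>j. (a t j)\<^sup>2)"
    proof (rule summable_comparison_test')
      show "summable (\<lambda>j. K\<^sup>2 * (c j)\<^sup>2)" using c by (rule summable_mult)
      show "norm ((a t j)\<^sup>2) \<le> K\<^sup>2 * (c j)\<^sup>2" if "j \<ge> 0" for j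
        using power_mono[OF bound[OF \<open>t \<in> S\<close>] abs_ge_zero, of j 2] by (simp add: power_mult_distrib)
    qed
    then have "(\<lambda>m. \<Sum>j<m. a t j *\<^sub>R e j) \<longlonglongrightarrow> synth (a t)"
      using synth_sums by (simp add: sums_def)
    then have "(\<lambda>m. (\<Sum>j<m. a t j *\<^sub>R e j) - (\<Sum>j<n. a t j *\<^sub>R e j))
        \<longlonglongrightarrow> synth (a t) - (\<Sum>j<n. a t j *\<^sub>R e j)"
      by (intro tendsto_intros)
    moreover have "\<forall>\<^sub>F m in sequentially.
        norm ((\<Sum>j<m. a t j *\<^sub>R e j) - (\<Sum>j<n. a t j *\<^sub>R e j)) \<le> \<epsilon> / 2"
      using eventually_ge_at_top[of n]
    proof eventually_elim
      case (elim m)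
      have "(\<Sum>j<m. a t j *\<^sub>R e j) - (\<Sum>j<n. a t j *\<^sub>R e j) = (\<Sum>j\<in>{n..<m}. a t j *\<^sub>R e j)"
        using sum_diff_nat_ivl[of 0 n m] elim by (simp add: lessThan_atLeast0)
      then show ?case
        using norm_block_le[OF bound[OF \<open>t \<in> S\<close>] N[OF \<open>n \<ge> N\<close>]] \<open>0 < K\<close> \<open>0 < \<epsilon>\<close> by simp
    qed
    ultimately have "norm (synth (a t) - (\<Sum>j<n. a t j *\<^sub>R e j)) \<le> \<epsilon> / 2"
      by (intro Lim_norm_ubound[OF sequentially_bot])
    then show ?thesis using \<open>0 < \<epsilon>\<close> by (simp add: dist_norm norm_minus_commute)
  qed
  then show "\<forall>\<^sub>F n in sequentially. \<forall>t\<in>S. dist (\<Sum>j<n. a t j *\<^sub>R e j) (synth (a t)) < \<epsilon>"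
    unfolding eventually_sequentially by blast
qed

lemma synth_inner:
  assumes "summable (\<lambda>j. (c j)\<^sup>2)"
  shows "synth c \<bullet> e k = c k"
proof -
  have "(\<lambda>j. (c j *\<^sub>R e j) \<bullet> e k) sums (synth c \<bullet> e k)"
    using synth_sums[OF assms] by (rule bounded_linear.sums[OF bounded_linear_inner_left])
  moreover have "(\<lambda>j. (c j *\<^sub>R e j) \<bullet> e k) = (\<lambda>j. if j = k then c j else 0)"
    by (auto simp: orthonormal)
  ultimately have "(\<lambda>j. if j = k then c j else 0) sums (synth c \<bullet> e k)" by simp
  then show ?thesis by (rule sums_unique2) (rule sums_single)
qed

lemma synth_in_closed_hull:
  assumes "summable (\<lambda>j. (c j)\<^sup>2)"
  shows "synth c \<in> closed_hull"
  unfolding closed_hull_def closure_sequential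
proof (intro exI conjI allI)
  show "(\<lambda>n. \<Sum>j<n. c j *\<^sub>R e j) \<longlonglongrightarrow> synth c"
    using synth_sums[OF assms] by (simp add: sums_def)
  show "(\<Sum>j<n. c j *\<^sub>R e j) \<in> span (range e)" for n
    by (intro span_sum span_scale span_base) auto
qed

lemma synth_scaleR:
  "summable (\<lambda>j. (c j)\<^sup>2) \<Longrightarrow> synth (\<lambda>j. r * c j) = r *\<^sub>R synth c"
  using suminf_scaleR_right[OF sums_summable[OF synth_sums], of c r] by (simp add: synth_def)

lemma synth_diff:
  "summable (\<lambda>j. (a j)\<^sup>2) \<Longrightarrow> summable (\<lambda>j. (c j)\<^sup>2) \<Longrightarrow>
    synth (\<lambda>j. a j - c j) = synth a - synth c"
  using suminf_diff[OF sums_summable[OF synth_sums] sums_summable[OF synth_sums], of a c]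
  by (simp add: synth_def scaleR_diff_left)

lemma bessel: "summable (\<lambda>j. (v \<bullet> e j)\<^sup>2)"
proof (rule summableI_nonneg_bounded)
  fix n
  define s where "s = (\<Sum>j<n. (v \<bullet> e j) *\<^sub>R e j)"
  have "(norm s)\<^sup>2 = v \<bullet> s"
    unfolding s_def norm_sum_squared[OF finite_lessThan] by (simp add: inner_sum_right power2_eq_square)
  also have "\<dots> \<le> norm v * norm s" by (rule norm_cauchy_schwarz)
  finally have "norm s \<le> norm v"
    by (cases "s = 0") (simp_all add: power2_eq_square)
  then have "(norm s)\<^sup>2 \<le> (norm v)\<^sup>2" by (simp add: power_mono)
  then show "(\<Sum>j<n. (v \<bullet> e j)\<^sup>2) \<le> (norm v)\<^sup>2"
    by (simp add: s_def norm_sum_squared)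
qed simp

lemma orthogonal_closed_hull:
  assumes "\<And>j. d \<bullet> e j = 0" "v \<in> closed_hull"
  shows "d \<bullet> v = 0"
proof -
  have "span (range e) \<subseteq> {x. d \<bullet> x = 0}"
    using assms(1) by (intro span_minimal subspace_hyperplane) auto
  then have "closed_hull \<subseteq> {x. d \<bullet> x = 0}"
    unfolding closed_hull_def by (intro closure_minimal closed_hyperplane)
  with assms(2) show ?thesis by auto
qed

text \<open>The difference between \<open>v\<close> and its expansion is orthogonal to every \<open>e j\<close>, hence to the closed
  hull, which contains that difference.\<close>

lemma expansion:
  assumes "v \<in> closed_hull"
  shows "synth (\<lambda>j. v \<bullet> e j) = v"
proof -
  define d where "d = v - synth (\<lambda>j. v \<bullet> e j)"
  have "d \<bullet> e j = 0" for j by (simp add: d_def inner_diff_left synth_inner bessel)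
  then have "d \<bullet> x = 0" if "x \<in> closed_hull" for x
    using that by (rule orthogonal_closed_hull)
  from this[OF assms] this[OF synth_in_closed_hull[OF bessel]]
  have "d \<bullet> (v - synth (\<lambda>j. v \<bullet> e j)) = 0" by (simp add: inner_diff_right)
  then have "d \<bullet> d = 0" by (simp add: d_def)
  then show ?thesis by (simp add: d_def)
qed

lemma subspace_closed_hull: "subspace closed_hull"
proof -
  have "synth (\<lambda>j. a j + c j) = synth a + synth c"
    if "summable (\<lambda>j. (a j)\<^sup>2)" "summable (\<lambda>j. (c j)\<^sup>2)" for a c
    using suminf_add[OF sums_summable[OF synth_sums] sums_summable[OF synth_sums], OF that]
    by (simp add: synth_def scaleR_add_left)
  from this[OF bessel bessel] have "x + y \<in> closed_hull" if "x \<in> closed_hull" "y \<in> closed_hull" for x y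
    using synth_in_closed_hull[OF bessel[of "x + y"]] that by (simp add: inner_add_left expansion)
  moreover have "r *\<^sub>R x \<in> closed_hull" if "x \<in> closed_hull" for x r
    using synth_in_closed_hull[OF bessel[of "r *\<^sub>R x"]] that by (simp add: synth_scaleR bessel expansion)
  moreover have "0 \<in> closed_hull"
    using synth_in_closed_hull[of "\<lambda>_. 0"] by (simp add: synth_def)
  ultimately show ?thesis by (simp add: subspace_def)
qed

lemma coefficients_eqD:
  assumes "v \<in> closed_hull" "w \<in> closed_hull" "\<And>j. v \<bullet> e j = w \<bullet> e j"
  shows "v = w"
proof -
  have "synth (\<lambda>j. v \<bullet> e j) = synth (\<lambda>j. w \<bullet> e j)" by (simp only: assms(3))
  then show ?thesis by (simp only: expansion assms(1,2))
qed

end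

section \<open>Semigroups of diagonal operators bounded below\<close>

text \<open>The estimates for the semigroup are uniform only on bounded time intervals; this passes from these
  to the half-line.\<close>

lemma at_within_atLeast_eq_Icc:
  fixes t :: real
  assumes "0 \<le> t"
  shows "at t within {0..} = at t within {0..t + 1}"
  by (rule at_within_nhd[of _ "{..<t + 1}"]) auto

locale semibounded_diagonal = orthonormal_sequence e
  for e :: "nat \<Rightarrow> 'h::{real_inner, banach}" +
  fixes p :: "nat \<Rightarrow> real" and L :: real
  assumes L_nonneg: "0 \<le> L" and lower_bound: "- L \<le> p j"
begin

text \<open>The generator of the semigroup is \<open>- gen\<close>. Where the coefficients are not square-summable, the
  value of \<open>gen\<close> carries no meaning.\<close>

definition gen :: "'h \<Rightarrow> 'h" where
  "gen v = synth (\<lambda>j. p j * (v \<bullet> e j))"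

definition dom_gen :: "'h set" where
  "dom_gen = {v \<in> closed_hull. summable (\<lambda>j. (p j * (v \<bullet> e j))\<^sup>2)}"

definition semi :: "real \<Rightarrow> 'h \<Rightarrow> 'h" where
  "semi t v = synth (\<lambda>j. exp (- t * p j) * (v \<bullet> e j))"

lemma exp_bound:
  assumes "0 \<le> t" "t \<le> b"
  shows "exp (- t * p j) \<le> exp (b * L)"
proof -
  have "t * (- p j) \<le> t * L" using lower_bound[of j] assms by (intro mult_left_mono) auto
  also have "\<dots> \<le> b * L" using assms L_nonneg by (intro mult_right_mono)
  finally show ?thesis by simp
qed

lemma summable_bounded_multiplier:
  fixes m c :: "nat \<Rightarrow> real"
  assumes "\<And>j. \<bar>m j\<bar> \<le> K" "summable (\<lambda>j. (c j)\<^sup>2)"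
  shows "summable (\<lambda>j. (m j * c j)\<^sup>2)"
proof (rule summable_comparison_test')
  show "summable (\<lambda>j. K\<^sup>2 * (c j)\<^sup>2)" using assms(2) by (rule summable_mult)
  show "norm ((m j * c j)\<^sup>2) \<le> K\<^sup>2 * (c j)\<^sup>2" if "j \<ge> 0" for j
    using power_mono[OF assms(1) abs_ge_zero, of j 2]
    by (simp add: power_mult_distrib mult_right_mono)
qed

lemma summable_exp:
  assumes "0 \<le> t" "summable (\<lambda>j. (c j)\<^sup>2)"
  shows "summable (\<lambda>j. (exp (- t * p j) * c j)\<^sup>2)"
  by (rule summable_bounded_multiplier[where K = "exp (t * L)"])
     (use assms exp_bound[OF assms(1) order_refl] in auto)

lemma semi_inner: "0 \<le> t \<Longrightarrow> semi t v \<bullet> e j = exp (- t * p j) * (v \<bullet> e j)"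
  unfolding semi_def by (intro synth_inner summable_exp bessel)

lemma semi_in_closed_hull: "0 \<le> t \<Longrightarrow> semi t v \<in> closed_hull"
  unfolding semi_def by (intro synth_in_closed_hull summable_exp bessel)

lemma semi_0: "v \<in> closed_hull \<Longrightarrow> semi 0 v = v"
  by (simp add: semi_def expansion)

lemma semi_semi: "0 \<le> s \<Longrightarrow> 0 \<le> t \<Longrightarrow> semi s (semi t v) = semi (s + t) v"
  by (rule coefficients_eqD)
     (simp_all add: semi_in_closed_hull semi_inner algebra_simps flip: exp_add)

text \<open>No multiplier \<open>exp (- t * p j)\<close> vanishes, so an orbit cannot reach \<open>0\<close> in finite time and may be
  normalized.\<close>

lemma semi_nonzero:
  assumes "v \<in> closed_hull" "v \<noteq> 0" "0 \<le> t"
  shows "semi t v \<noteq> 0"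
proof
  assume "semi t v = 0"
  then have "exp (- t * p j) * (v \<bullet> e j) = 0" for j
    using semi_inner[OF assms(3), of v j] by simp
  then have "v \<bullet> e j = 0 \<bullet> e j" for j by simp
  then have "v = 0"
    using assms(1) subspace_0[OF subspace_closed_hull] by (intro coefficients_eqD)
  with assms(2) show False by simp
qed

lemma uniform_limit_exp:
  assumes "summable (\<lambda>j. (c j)\<^sup>2)"
  shows "uniform_limit {0..b} (\<lambda>n t. \<Sum>j<n. (exp (- t * p j) * c j) *\<^sub>R e j)
    (\<lambda>t. synth (\<lambda>j. exp (- t * p j) * c j)) sequentially"
proof (rule uniform_limit_synth[OF _ assms])
  show "\<bar>exp (- t * p j) * c j\<bar> \<le> exp (b * L) * \<bar>c j\<bar>" if "t \<in> {0..b}" for t j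
    using exp_bound[of t b j] that by (simp add: abs_mult mult_right_mono)
qed simp

lemma semi_continuous: "continuous_on {0..} (\<lambda>t. semi t v)"
proof -
  have "continuous_on {0..b} (\<lambda>t. semi t v)" for b
    unfolding semi_def
    by (rule uniform_limit_theorem[OF _ uniform_limit_exp[OF bessel]])
       (auto intro!: continuous_intros always_eventually)
  then have "continuous (at t within {0..}) (\<lambda>t. semi t v)" if "0 \<le> t" for t
    using that by (simp add: at_within_atLeast_eq_Icc continuous_on_eq_continuous_within)
  then show ?thesis by (simp add: continuous_on_eq_continuous_within)
qed

lemma gen_inner: "v \<in> dom_gen \<Longrightarrow> gen v \<bullet> e j = p j * (v \<bullet> e j)"
  by (simp add: gen_def dom_gen_def synth_inner)

lemma gen_in_closed_hull: "v \<in> dom_gen \<Longrightarrow> gen v \<in> closed_hull"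
  by (simp add: gen_def dom_gen_def synth_in_closed_hull)

lemma dom_gen_closed_hull: "v \<in> dom_gen \<Longrightarrow> v \<in> closed_hull"
  by (simp add: dom_gen_def)

lemma gen_scaleR:
  assumes "v \<in> dom_gen"
  shows "r *\<^sub>R v \<in> dom_gen" "gen (r *\<^sub>R v) = r *\<^sub>R gen v"
proof -
  have s: "summable (\<lambda>j. (p j * (v \<bullet> e j))\<^sup>2)" using assms by (simp add: dom_gen_def)
  have eq: "p j * (r *\<^sub>R v \<bullet> e j) = r * (p j * (v \<bullet> e j))" for j by simp
  show "gen (r *\<^sub>R v) = r *\<^sub>R gen v"
    unfolding gen_def eq by (rule synth_scaleR[OF s])
  have "summable (\<lambda>j. (r * (p j * (v \<bullet> e j)))\<^sup>2)"
    using summable_mult[OF s, of "r\<^sup>2"] by (simp add: power_mult_distrib)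
  then show "r *\<^sub>R v \<in> dom_gen"
    using assms subspace_scale[OF subspace_closed_hull, of v r]
    unfolding dom_gen_def mem_Collect_eq eq by blast
qed

lemma gen_diff:
  assumes "v \<in> dom_gen" "w \<in> dom_gen"
  shows "gen (v - w) = gen v - gen w"
  using synth_diff[of "\<lambda>j. p j * (v \<bullet> e j)" "\<lambda>j. p j * (w \<bullet> e j)"] assms
  by (simp add: dom_gen_def gen_def inner_diff_left right_diff_distrib)

lemma gen_semi:
  assumes "v \<in> dom_gen" "0 \<le> t"
  shows "semi t v \<in> dom_gen" "gen (semi t v) = semi t (gen v)"
proof -
  have s: "summable (\<lambda>j. (p j * (v \<bullet> e j))\<^sup>2)" using assms by (simp add: dom_gen_def)
  have eq: "p j * (semi t v \<bullet> e j) = exp (- t * p j) * (p j * (v \<bullet> e j))" for j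
    using assms by (simp add: semi_inner)
  show dom: "semi t v \<in> dom_gen"
    using summable_exp[OF assms(2) s] semi_in_closed_hull[OF assms(2)]
    unfolding dom_gen_def mem_Collect_eq eq by blast
  show "gen (semi t v) = semi t (gen v)"
    unfolding gen_def[of "semi t v"] eq semi_def[of t "gen v"] using assms(1) by (simp add: gen_inner)
qed

text \<open>For \<open>v\<close> in the domain, the termwise derivatives have coefficients \<open>- exp (- s * p j) * (p j * (v \<bullet> e j))\<close>,
  which belong to the negative of the orbit of \<open>gen v\<close>. Their partial sums therefore converge uniformly on bounded time
  intervals, and differentiation passes to the limit.\<close>

lemma semi_has_derivative:
  assumes v: "v \<in> dom_gen" and t: "0 \<le> t"
  shows "((\<lambda>s. semi s v) has_vector_derivative - gen (semi t v)) (at t within {0..})"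
proof -
  define b where "b = t + 1"
  define c where "c = (\<lambda>j. v \<bullet> e j)"
  define f where "f = (\<lambda>n s. \<Sum>j<n. (exp (- s * p j) * c j) *\<^sub>R e j)"
  define f' where "f' = (\<lambda>n s. \<Sum>j<n. (exp (- s * p j) * (p j * c j)) *\<^sub>R e j)"
  have lim_f: "uniform_limit {0..b} f (\<lambda>s. semi s v) sequentially"
    unfolding f_def c_def semi_def by (rule uniform_limit_exp[OF bessel])
  have "summable (\<lambda>j. (p j * c j)\<^sup>2)" using v by (simp add: dom_gen_def c_def)
  from uniform_limit_exp[OF this] have lim_f':
    "uniform_limit {0..b} f' (\<lambda>s. semi s (gen v)) sequentially"
    using v by (simp add: f'_def c_def semi_def gen_inner)
  have "\<exists>g. \<forall>s\<in>{0..b}. (\<lambda>n. f n s) \<longlonglongrightarrow> g s \<and>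
      (g has_derivative (\<lambda>h. h *\<^sub>R - semi s (gen v))) (at s within {0..b})"
  proof (rule has_derivative_sequence)
    show "(f n has_derivative (\<lambda>h. h *\<^sub>R - f' n s)) (at s within {0..b})" for n s
    proof -
      have "(f n has_vector_derivative (\<Sum>j<n. (- p j * exp (- s * p j) * c j) *\<^sub>R e j)) (at s within {0..b})"
        unfolding f_def
      proof (rule has_vector_derivative_sum)
        fix j
        have "((\<lambda>s. exp (- s * p j) * c j) has_real_derivative - p j * exp (- s * p j) * c j)
            (at s within {0..b})"
          by (auto intro!: derivative_eq_intros)
        from has_vector_derivative_scaleR[OF this has_vector_derivative_const]
        show "((\<lambda>s. (exp (- s * p j) * c j) *\<^sub>R e j) has_vector_derivative
            (- p j * exp (- s * p j) * c j) *\<^sub>R e j) (at s within {0..b})" by simp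
      qed
      moreover have "(\<Sum>j<n. (- p j * exp (- s * p j) * c j) *\<^sub>R e j) = - f' n s"
        by (simp add: f'_def sum_negf[symmetric] algebra_simps)
      ultimately show ?thesis by (simp add: has_vector_derivative_def)
    qed
    show "\<forall>\<^sub>F n in sequentially. \<forall>s\<in>{0..b}. \<forall>h.
        norm (h *\<^sub>R - f' n s - h *\<^sub>R - semi s (gen v)) \<le> \<epsilon> * norm h" if "0 < \<epsilon>" for \<epsilon>
      using uniform_limitD[OF lim_f' that]
    proof eventually_elim
      case (elim n)
      have "norm (h *\<^sub>R - f' n s - h *\<^sub>R - semi s (gen v)) \<le> \<epsilon> * norm h" if "s \<in> {0..b}" for s h
      proof -
        have "h *\<^sub>R - f' n s - h *\<^sub>R - semi s (gen v) = - (h *\<^sub>R (f' n s - semi s (gen v)))"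
          by (simp add: algebra_simps)
        then have "norm (h *\<^sub>R - f' n s - h *\<^sub>R - semi s (gen v)) = \<bar>h\<bar> * dist (f' n s) (semi s (gen v))"
          by (simp add: dist_norm)
        also have "\<dots> \<le> \<bar>h\<bar> * \<epsilon>" using elim that by (intro mult_left_mono) (auto intro: less_imp_le)
        finally show ?thesis by (simp add: mult.commute)
      qed
      then show ?case by blast
    qed
    show "t \<in> {0..b}" using t by (simp add: b_def)
    then show "(\<lambda>n. f n t) \<longlonglongrightarrow> semi t v" by (rule tendsto_uniform_limitI[OF lim_f])
  qed simp
  then obtain g where g: "\<And>s. s \<in> {0..b} \<Longrightarrow> (\<lambda>n. f n s) \<longlonglongrightarrow> g s"
    "\<And>s. s \<in> {0..b} \<Longrightarrow> (g has_vector_derivative - semi s (gen v)) (at s within {0..b})"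
    unfolding has_vector_derivative_def by blast
  have "g s = semi s v" if "s \<in> {0..b}" for s
    using g(1)[OF that] tendsto_uniform_limitI[OF lim_f that] by (rule LIMSEQ_unique)
  then have "((\<lambda>s. semi s v) has_vector_derivative - semi t (gen v)) (at t within {0..b})"
    using t by (intro has_vector_derivative_transform[OF _ _ g(2)]) (auto simp: b_def)
  then show ?thesis
    using t by (simp add: at_within_atLeast_eq_Icc b_def gen_semi[OF v])
qed

text \<open>Where \<open>p j\<close> is positive, \<open>x \<le> exp x\<close> at \<open>x = t * p j\<close> gives the bound \<open>1 / t\<close>; where it is
  negative, the semibound gives the second summand.\<close>

lemma exp_multiplier_bound:
  assumes "0 < t"
  shows "\<bar>p j * exp (- t * p j)\<bar> \<le> 1 / t + L * exp (t * L)"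
proof (cases "0 \<le> p j")
  case True
  have "t * p j \<le> exp (t * p j)" using exp_ge_add_one_self[of "t * p j"] by linarith
  then have "p j * exp (- t * p j) \<le> 1 / t"
    using assms by (simp add: exp_minus field_simps)
  moreover have "0 \<le> L * exp (t * L)" using L_nonneg by simp
  ultimately show ?thesis using True by (simp add: abs_mult)
next
  case False
  have "\<bar>p j\<bar> * exp (- t * p j) \<le> L * exp (t * L)"
    using False lower_bound[of j] exp_bound[of t t j] assms L_nonneg by (intro mult_mono) auto
  moreover have "0 \<le> 1 / t" using assms by simp
  ultimately show ?thesis by (simp add: abs_mult del: zero_le_divide_1_iff)
qed

lemma semi_smoothing:
  assumes "0 < t"
  shows "semi t v \<in> dom_gen"
proof -
  have "summable (\<lambda>j. ((p j * exp (- t * p j)) * (v \<bullet> e j))\<^sup>2)"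
    by (rule summable_bounded_multiplier[OF exp_multiplier_bound[OF assms] bessel])
  then show ?thesis using assms by (simp add: dom_gen_def semi_in_closed_hull semi_inner mult.assoc)
qed

text \<open>Since \<open>semi (t / 2)\<close> already maps into the domain, everything at a positive time \<open>t\<close> follows from
  the case of initial data in the domain by restarting the orbit at time \<open>t / 2\<close>.\<close>

lemma gen_semi_continuous_positive: "continuous_on {0<..} (\<lambda>t. gen (semi t v))"
proof (rule continuous_at_imp_continuous_on, rule ballI)
  fix t :: real assume "t \<in> {0<..}"
  define \<tau> where "\<tau> = t / 2"
  have \<tau>: "0 < \<tau>" "\<tau> < t" using \<open>t \<in> _\<close> by (auto simp: \<tau>_def)
  have "continuous_on {\<tau><..} (\<lambda>s. semi (s - \<tau>) (gen (semi \<tau> v)))"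
    by (rule continuous_on_compose2[OF semi_continuous]) (auto intro!: continuous_intros)
  moreover have "semi (s - \<tau>) (gen (semi \<tau> v)) = gen (semi s v)" if "s \<in> {\<tau><..}" for s
    using that \<tau> by (simp add: gen_semi(2)[OF semi_smoothing[OF \<tau>(1)], symmetric] semi_semi)
  ultimately have "continuous_on {\<tau><..} (\<lambda>s. gen (semi s v))"
    by (rule continuous_on_eq)
  then show "isCont (\<lambda>t. gen (semi t v)) t"
    using \<tau> by (simp add: continuous_on_eq_continuous_at)
qed

lemma semi_has_derivative_positive:
  assumes "0 < t"
  shows "((\<lambda>s. semi s v) has_vector_derivative - gen (semi t v)) (at t)"
proof -
  define \<tau> where "\<tau> = t / 2"
  have \<tau>: "0 < \<tau>" "\<tau> < t" using assms by (auto simp: \<tau>_def)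
  define w where "w = semi \<tau> v"
  have w: "w \<in> dom_gen" unfolding w_def by (rule semi_smoothing[OF \<tau>(1)])
  have shift: "semi (s - \<tau>) w = semi s v" if "\<tau> \<le> s" for s
    using that \<tau> by (simp add: w_def semi_semi)
  have "((\<lambda>s. semi s w) has_vector_derivative - gen (semi (t - \<tau>) w)) (at (t - \<tau>))"
    using has_vector_derivative_within_subset[OF semi_has_derivative[OF w], of "t - \<tau>" "{0<..}"] \<tau>
    by (simp add: at_within_open[of "t - \<tau>" "{0<..}"] subset_iff)
  moreover have "((\<lambda>s. s - \<tau>) has_vector_derivative 1) (at t)"
    by (auto intro!: derivative_eq_intros)
  ultimately have "((\<lambda>s. semi (s - \<tau>) w) has_vector_derivative - gen (semi t v)) (at t)"
    using vector_diff_chain_at[of "\<lambda>s. s - \<tau>" 1 t "\<lambda>s. semi s w"] \<tau> by (simp add: o_def shift)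
  then show ?thesis
    by (rule has_vector_derivative_transform_within_open[where S = "{\<tau><..}"]) (use \<tau> shift in auto)
qed

end

section \<open>The projected flow of a diagonal operator\<close>

text \<open>Normalization removes the radial part of the velocity and rescales the rest. This is where the
  projection in the flow equation comes from.\<close>

lemma has_vector_derivative_normalize:
  fixes y :: "real \<Rightarrow> 'h::real_inner"
  assumes y: "(y has_vector_derivative y') (at t within S)" and "y t \<noteq> 0"
  shows "((\<lambda>s. y s /\<^sub>R norm (y s)) has_vector_derivative
    tproj (y t /\<^sub>R norm (y t)) (y' /\<^sub>R norm (y t))) (at t within S)"
proof -
  have "((\<lambda>s. norm (y s)) has_derivative (\<lambda>h. (h *\<^sub>R y') \<bullet> sgn (y t))) (at t within S)"
    using y has_derivative_norm[OF assms(2)] unfolding has_vector_derivative_def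
    by (rule has_derivative_compose)
  then have "((\<lambda>s. norm (y s)) has_real_derivative y' \<bullet> sgn (y t)) (at t within S)"
    by (simp add: has_field_derivative_def mult_commute_abs)
  from DERIV_inverse'[OF this] assms(2)
  have "((\<lambda>s. inverse (norm (y s))) has_real_derivative
      - (inverse (norm (y t)) * (y' \<bullet> sgn (y t)) * inverse (norm (y t)))) (at t within S)"
    by simp
  from has_vector_derivative_scaleR[OF this y] show ?thesis
    by (simp add: tproj_def sgn_div_norm mult_ac)
qed

text \<open>The factor \<open>g\<close> is \<open>exp (\<integral> \<alpha>)\<close>. What matters below is that it is positive and the same
  for all solutions \<open>z\<close>.\<close>

lemma linear_ode_propagator:
  fixes \<alpha> :: "real \<Rightarrow> real"
  assumes "continuous_on {a..b} \<alpha>" "a \<le> b"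
  shows "\<exists>g>0. \<forall>z. (\<forall>t\<in>{a..b}. (z has_real_derivative \<alpha> t * z t) (at t within {a..b})) \<longrightarrow>
    z b = g * z a"
proof -
  obtain G where G: "\<And>t. t \<in> {a..b} \<Longrightarrow> (G has_real_derivative \<alpha> t) (at t within {a..b})"
    using antiderivative_continuous[OF assms(1)]
    unfolding has_real_derivative_iff_has_vector_derivative by blast
  have "z b = exp (G b - G a) * z a"
    if z: "\<And>t. t \<in> {a..b} \<Longrightarrow> (z has_real_derivative \<alpha> t * z t) (at t within {a..b})" for z
  proof -
    have "\<exists>c. \<forall>t\<in>{a..b}. exp (- G t) * z t = c"
    proof (rule has_field_derivative_zero_constant)
      show "((\<lambda>t. exp (- G t) * z t) has_real_derivative 0) (at t within {a..b})" if "t \<in> {a..b}" for t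
        by (rule derivative_eq_intros G[OF that] z[OF that] refl)+ (simp add: algebra_simps)
    qed simp
    then have "exp (- G b) * z b = exp (- G a) * z a" using assms(2) by force
    then have "exp (G b) * (exp (- G b) * z b) = exp (G b) * (exp (- G a) * z a)" by simp
    then show ?thesis by (simp add: mult.assoc[symmetric] flip: exp_add)
  qed
  then show ?thesis by (intro exI[of _ "exp (G b - G a)"]) simp
qed

context semibounded_diagonal
begin

definition flow :: "'h \<Rightarrow> real \<Rightarrow> 'h" where
  "flow v t = semi t v /\<^sub>R norm (semi t v)"

lemma flow_in_closed_hull: "0 \<le> t \<Longrightarrow> flow v t \<in> closed_hull"
  unfolding flow_def by (intro subspace_scale subspace_closed_hull semi_in_closed_hull)

lemma norm_flow: "v \<in> closed_hull \<Longrightarrow> v \<noteq> 0 \<Longrightarrow> 0 \<le> t \<Longrightarrow> norm (flow v t) = 1"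
  using semi_nonzero by (simp add: flow_def)

lemma flow_0: "v \<in> closed_hull \<Longrightarrow> norm v = 1 \<Longrightarrow> flow v 0 = v"
  by (simp add: flow_def semi_0)

lemma flow_continuous:
  assumes "v \<in> closed_hull" "v \<noteq> 0"
  shows "continuous_on {0..} (flow v)"
  unfolding flow_def using semi_nonzero[OF assms]
  by (intro continuous_intros semi_continuous) auto

text \<open>This is applied with \<open>I = {0<..}\<close> for general initial data and with \<open>I = {0..}\<close> for initial data in
  the domain.\<close>

lemma flow_regular:
  assumes v: "v \<in> closed_hull" "v \<noteq> 0" and I: "I \<subseteq> {0..}"
    and dom: "\<And>t. t \<in> I \<Longrightarrow> semi t v \<in> dom_gen"
    and cont: "continuous_on I (\<lambda>t. gen (semi t v))"
    and deriv: "\<And>t. t \<in> I \<Longrightarrow>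
      ((\<lambda>s. semi s v) has_vector_derivative - gen (semi t v)) (at t within I)"
  shows "\<And>t. t \<in> I \<Longrightarrow> flow v t \<in> dom_gen"
    and "continuous_on I (\<lambda>t. gen (flow v t))"
    and "\<And>t. t \<in> I \<Longrightarrow> (flow v has_vector_derivative - tproj (flow v t) (gen (flow v t))) (at t within I)"
proof -
  note nz = semi_nonzero[OF v]
  show "flow v t \<in> dom_gen" if "t \<in> I" for t
    using gen_scaleR(1)[OF dom[OF that]] by (simp add: flow_def)
  have gen_flow: "gen (flow v t) = gen (semi t v) /\<^sub>R norm (semi t v)" if "t \<in> I" for t
    using gen_scaleR(2)[OF dom[OF that]] by (simp add: flow_def)
  have "continuous_on I (\<lambda>t. gen (semi t v) /\<^sub>R norm (semi t v))"
    using nz I by (intro continuous_intros cont continuous_on_subset[OF semi_continuous]) auto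
  then show "continuous_on I (\<lambda>t. gen (flow v t))"
    by (rule continuous_on_eq) (simp add: gen_flow)
  show "(flow v has_vector_derivative - tproj (flow v t) (gen (flow v t))) (at t within I)"
    if t: "t \<in> I" for t
  proof -
    have "semi t v \<noteq> 0" using nz I t by auto
    from has_vector_derivative_normalize[OF deriv[OF t] this] show ?thesis
      unfolding gen_flow[OF t] unfolding flow_def by (simp add: tproj_def)
  qed
qed

text \<open>The nonlinear term of the equation is \<open>\<alpha> t *\<^sub>R v t\<close> with the scalar \<open>\<alpha> t = gen (v t) \<bullet> v t\<close>.
  Hence all the functions \<open>z j t = exp (t * p j) * (v t \<bullet> e j)\<close> solve one and the same linear
  equation \<open>z' = \<alpha> z\<close>, and so their mutual ratios and their signs are preserved in time. The
  function \<open>\<alpha>\<close> may fail to be integrable near \<open>0\<close>. The propagation is therefore carried out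
  on \<open>[\<epsilon>, t]\<close>, the propagator is eliminated by cross-multiplying two coefficients, and only then
  \<open>\<epsilon>\<close> tends to \<open>0\<close>. The outcome is that \<open>v t\<close> is a nonnegative multiple of \<open>semi t v0\<close>,
  and the unit norm fixes the multiple.\<close>

lemma flow_unique:
  assumes v0: "v0 \<in> closed_hull" "v0 \<noteq> 0"
    and v_hull: "\<And>t. 0 \<le> t \<Longrightarrow> v t \<in> closed_hull" and v_norm: "\<And>t. 0 \<le> t \<Longrightarrow> norm (v t) = 1"
    and v_0: "v 0 = v0" and v_cont: "continuous_on {0..} v"
    and v_dom: "\<And>t. 0 < t \<Longrightarrow> v t \<in> dom_gen"
    and gen_cont: "continuous_on {0<..} (\<lambda>t. gen (v t))"
    and v_deriv: "\<And>t. 0 < t \<Longrightarrow>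
      (v has_vector_derivative - tproj (v t) (gen (v t))) (at t)"
    and t: "0 < t"
  shows "v t = flow v0 t"
proof -
  define \<alpha> where "\<alpha> = (\<lambda>s. gen (v s) \<bullet> v s)"
  define z where "z = (\<lambda>j s. exp (s * p j) * (v s \<bullet> e j))"
  have z_deriv: "(z j has_real_derivative \<alpha> s * z j s) (at s)" if "0 < s" for j s
  proof -
    have "((\<lambda>s. v s \<bullet> e j) has_vector_derivative - tproj (v s) (gen (v s)) \<bullet> e j) (at s)"
      by (rule bounded_linear.has_vector_derivative[OF bounded_linear_inner_left v_deriv[OF that]])
    moreover have "- tproj (v s) (gen (v s)) \<bullet> e j = (\<alpha> s - p j) * (v s \<bullet> e j)"
      using gen_inner[OF v_dom[OF that]]
      by (simp add: tproj_def \<alpha>_def inner_diff_left algebra_simps)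
    ultimately have "((\<lambda>s. v s \<bullet> e j) has_real_derivative (\<alpha> s - p j) * (v s \<bullet> e j)) (at s)"
      by (simp add: has_real_derivative_iff_has_vector_derivative)
    then show ?thesis
      unfolding z_def by (auto intro!: derivative_eq_intros simp: algebra_simps)
  qed
  have \<alpha>_cont: "continuous_on {0<..} \<alpha>"
    unfolding \<alpha>_def
    by (intro continuous_intros gen_cont continuous_on_subset[OF v_cont]) auto
  have propagate: "\<exists>g>0. \<forall>j. z j t = g * z j \<epsilon>" if "0 < \<epsilon>" "\<epsilon> \<le> t" for \<epsilon>
  proof -
    have "continuous_on {\<epsilon>..t} \<alpha>"
      using that by (intro continuous_on_subset[OF \<alpha>_cont]) auto
    from linear_ode_propagator[OF this \<open>\<epsilon> \<le> t\<close>] obtain g where "0 < g"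
      and g: "\<forall>y. (\<forall>s\<in>{\<epsilon>..t}. (y has_real_derivative \<alpha> s * y s) (at s within {\<epsilon>..t})) \<longrightarrow>
        y t = g * y \<epsilon>" by blast
    have "\<forall>s\<in>{\<epsilon>..t}. (z j has_real_derivative \<alpha> s * z j s) (at s within {\<epsilon>..t})" for j
    proof
      show "(z j has_real_derivative \<alpha> s * z j s) (at s within {\<epsilon>..t})" if "s \<in> {\<epsilon>..t}" for s
        using that \<open>0 < \<epsilon>\<close> by (intro has_field_derivative_at_within[OF z_deriv]) auto
    qed
    then have "z j t = g * z j \<epsilon>" for j
      by (rule g[THEN spec, THEN mp])
    then show ?thesis using \<open>0 < g\<close> by blast
  qed
  have near_0: "\<forall>\<^sub>F \<epsilon> in at_right 0. 0 < \<epsilon> \<and> \<epsilon> \<le> t"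
    using eventually_at_right_real[OF t] by eventually_elim auto
  have z_lim: "((\<lambda>\<epsilon>. z j \<epsilon>) \<longlongrightarrow> v0 \<bullet> e j) (at_right 0)" for j
  proof -
    have "(v \<longlongrightarrow> v 0) (at 0 within {0..})" using v_cont by (simp add: continuous_on_def)
    then have "(v \<longlongrightarrow> v0) (at_right 0)" unfolding v_0 by (rule tendsto_within_subset) auto
    then have "((\<lambda>\<epsilon>. exp (\<epsilon> * p j) * (v \<epsilon> \<bullet> e j)) \<longlongrightarrow> exp (0 * p j) * (v0 \<bullet> e j)) (at_right 0)"
      by (intro tendsto_intros)
    then show ?thesis by (simp add: z_def)
  qed
  have cross: "z i t * (v0 \<bullet> e j) = z j t * (v0 \<bullet> e i)" for i j
  proof (rule tendsto_unique[of "at_right (0::real)"])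
    show "((\<lambda>\<epsilon>. z i t * z j \<epsilon>) \<longlongrightarrow> z i t * (v0 \<bullet> e j)) (at_right 0)"
      by (intro tendsto_intros z_lim)
    have "((\<lambda>\<epsilon>. z j t * z i \<epsilon>) \<longlongrightarrow> z j t * (v0 \<bullet> e i)) (at_right 0)"
      by (intro tendsto_intros z_lim)
    then show "((\<lambda>\<epsilon>. z i t * z j \<epsilon>) \<longlongrightarrow> z j t * (v0 \<bullet> e i)) (at_right 0)"
    proof (rule Lim_transform_eventually)
      show "\<forall>\<^sub>F \<epsilon> in at_right 0. z j t * z i \<epsilon> = z i t * z j \<epsilon>"
        using near_0
      proof eventually_elim
        case (elim \<epsilon>)
        then obtain g where "\<And>j. z j t = g * z j \<epsilon>" using propagate by blast
        then show ?case by simp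
      qed
    qed
  qed simp
  have sign: "0 \<le> z j t * (v0 \<bullet> e j)" for j
  proof (rule tendsto_lowerbound)
    show "((\<lambda>\<epsilon>. z j t * z j \<epsilon>) \<longlongrightarrow> z j t * (v0 \<bullet> e j)) (at_right 0)"
      by (intro tendsto_intros z_lim)
    show "\<forall>\<^sub>F \<epsilon> in at_right 0. 0 \<le> z j t * z j \<epsilon>"
      using near_0
    proof eventually_elim
      case (elim \<epsilon>)
      then obtain g where "0 < g" "z j t = g * z j \<epsilon>" using propagate by blast
      then show ?case by (simp add: mult.assoc)
    qed
  qed simp
  obtain k where k: "v0 \<bullet> e k \<noteq> 0"
    using coefficients_eqD[OF v0(1) subspace_0[OF subspace_closed_hull]] v0(2) by auto
  define r where "r = z k t / (v0 \<bullet> e k)"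
  have "0 \<le> r"
    using sign[of k] k by (auto simp: r_def zero_le_divide_iff zero_le_mult_iff)
  have "v t = r *\<^sub>R semi t v0"
  proof (rule coefficients_eqD)
    show "v t \<bullet> e j = (r *\<^sub>R semi t v0) \<bullet> e j" for j
    proof -
      have "z j t = r * (v0 \<bullet> e j)" using cross[of j k] k by (simp add: r_def field_simps)
      then have "exp (- t * p j) * z j t = exp (- t * p j) * (r * (v0 \<bullet> e j))" by simp
      moreover have "exp (- t * p j) * z j t = v t \<bullet> e j"
        by (simp add: z_def mult.assoc[symmetric] flip: exp_add)
      ultimately show ?thesis using t by (simp add: semi_inner mult.left_commute)
    qed
  qed (use t v_hull semi_in_closed_hull subspace_scale[OF subspace_closed_hull] in auto)
  moreover from this have "r * norm (semi t v0) = 1"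
    using v_norm[of t] t \<open>0 \<le> r\<close> by simp
  then have "r = inverse (norm (semi t v0))" by (metis inverse_unique mult.commute)
  ultimately show ?thesis by (simp add: flow_def)
qed

end

section \<open>The flow of the polynomial Dirichlet Laplacian\<close>

text \<open>Near infinity the leading term makes the polynomial positive; on the remaining compact interval it
  attains its minimum.\<close>

lemma poly_bounded_below_at_nonneg:
  fixes P :: "real poly"
  assumes "lead_coeff P > 0"
  obtains L where "0 \<le> L" "\<And>x. 0 \<le> x \<Longrightarrow> - L \<le> poly P x"
proof -
  obtain n where n: "\<And>x. n \<le> x \<Longrightarrow> lead_coeff P \<le> poly P x"
    using poly_pinfty_gt_lc[OF assms] by blast
  have "continuous_on {0..max 0 n} (poly P)" by (intro continuous_intros)
  then obtain y where y: "\<And>x. x \<in> {0..max 0 n} \<Longrightarrow> poly P y \<le> poly P x"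
    using continuous_attains_inf[of "{0..max 0 n}" "poly P"]
    by (metis atLeastAtMost_iff compact_Icc empty_iff max.cobounded1 order_refl)
  have "- \<bar>poly P y\<bar> \<le> poly P x" if "0 \<le> x" for x
  proof (cases "x \<le> n")
    case True
    with that y[of x] show ?thesis by auto
  next
    case False
    with n[of x] assms show ?thesis by linarith
  qed
  then show thesis using that[of "\<bar>poly P y\<bar>"] by simp
qed

text \<open>Applied with \<open>c = exp (- t * \<kappa>)\<close>: the shift by \<open>\<kappa>\<close> rescales the semigroup and
  disappears under normalization.\<close>

lemma normalize_scaleR:
  fixes y :: "'a::real_normed_vector"
  assumes "0 < c"
  shows "(c *\<^sub>R y) /\<^sub>R norm (c *\<^sub>R y) = y /\<^sub>R norm y"
proof -
  have "inverse (c * norm y) * c = inverse (norm y)" using assms by simp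
  then show ?thesis using assms by simp
qed

lemma norm_PB_le_graph_norm: "norm (PB lam e P w) \<le> graph_norm lam e P w"
  unfolding graph_norm_def by (rule real_le_rsqrt) simp

theorem theorem3p2:
  fixes \<Omega> :: "(real ^ 'd) set"
    and lam :: "nat \<Rightarrow> real" and e :: "nat \<Rightarrow> (real ^ 'd) l2"
    and P :: "real poly" and \<kappa> :: real
    and u0 :: "(real ^ 'd) l2" and u :: "real \<Rightarrow> (real ^ 'd) l2"
  assumes "smooth_bounded_domain \<Omega>"
    and "dirichlet_eigenbasis \<Omega> lam e"
    and "degree P \<ge> 1" and "lead_coeff P > 0"
    and "\<kappa> > max 0 (1 - mu_P lam P)"
    and "u0 \<in> unit_sphere \<Omega>"
    and "\<And>t. t \<ge> 0 \<Longrightarrow> u t = S_P lam e P t u0 /\<^sub>R norm (S_P lam e P t u0)"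
  shows "(\<forall>t\<ge>0. u t = exp_A lam e P \<kappa> t u0 /\<^sub>R norm (exp_A lam e P \<kappa> t u0)) \<and>
    u \<in> C_H {0..} \<Omega> \<inter> C_dom {0<..} \<Omega> lam e P \<inter> C1_H {0<..} \<Omega> \<and>
    solves_flow \<Omega> lam e P u0 u \<and>
    (\<forall>v \<in> C_H {0..} \<Omega> \<inter> C_dom {0<..} \<Omega> lam e P \<inter> C1_H {0<..} \<Omega>.
       solves_flow \<Omega> lam e P u0 v \<longrightarrow> (\<forall>t\<ge>0. v t = u t)) \<and>
    (u0 \<in> dom_PB \<Omega> lam e P \<longrightarrow>
       u \<in> C_dom {0..} \<Omega> lam e P \<inter> C1_H {0..} \<Omega> \<and>
       (u has_vector_derivative - tproj (u 0) (PB lam e P (u 0))) (at 0 within {0..}))"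
proof -
  have lam: "0 < lam 0" "mono lam" and ortho: "\<And>i j. e i \<bullet> e j = (if i = j then 1 else 0)"
    and dense: "closure (span (range e)) = L2 \<Omega>"
    using assms(2) by (auto simp: dirichlet_eigenbasis_def)
  have lam_nonneg: "0 \<le> lam j" for j
    using lam monoD[OF lam(2), of 0 j] by simp
  obtain L where L: "0 \<le> L" "\<And>x. 0 \<le> x \<Longrightarrow> - L \<le> poly P x"
    using poly_bounded_below_at_nonneg[OF assms(4)] by blast
  interpret semibounded_diagonal e "\<lambda>j. poly P (lam j)" L
    by unfold_locales (auto simp: ortho L lam_nonneg)
  have hull: "closed_hull = L2 \<Omega>" by (simp add: closed_hull_def dense)
  have PB: "PB lam e P w = gen w" for w
    by (simp add: PB_def spectral_def gen_def synth_def)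
  have dom: "dom_PB \<Omega> lam e P = dom_gen"
    by (simp add: dom_PB_def dom_gen_def hull power_mult_distrib)
  have S: "S_P lam e P t w = semi t w" for t w
    by (simp add: S_P_def spectral_def semi_def synth_def)
  have u0: "u0 \<in> closed_hull" "norm u0 = 1" "u0 \<noteq> 0"
    using assms(6) by (auto simp: unit_sphere_def hull)
  have u: "u t = flow u0 t" if "0 \<le> t" for t
    using assms(7)[OF that] by (simp add: S flow_def)
  have u_H: "u t \<in> L2 \<Omega>" and u_norm: "norm (u t) = 1" if "0 \<le> t" for t
    using that u0 by (simp_all add: u flow_in_closed_hull norm_flow flip: hull)
  have u_cont: "continuous_on {0..} u"
    using flow_continuous[OF u0(1,3)] by (rule continuous_on_eq) (simp add: u)

  have exp_A: "u t = exp_A lam e P \<kappa> t u0 /\<^sub>R norm (exp_A lam e P \<kappa> t u0)" if "0 \<le> t" for t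
  proof -
    have "exp_A lam e P \<kappa> t u0 =
        synth (\<lambda>j. exp (- t * \<kappa>) * (exp (- t * poly P (lam j)) * (u0 \<bullet> e j)))"
      by (simp add: exp_A_def spectral_def synth_def algebra_simps mult_exp_exp)
    also have "\<dots> = exp (- t * \<kappa>) *\<^sub>R semi t u0"
      unfolding semi_def by (intro synth_scaleR summable_exp bessel that)
    finally show ?thesis
      using that by (simp only: normalize_scaleR exp_gt_zero u flow_def)
  qed

  have regular: "u \<in> C_dom I \<Omega> lam e P \<inter> C1_H I \<Omega> \<and>
      (\<forall>t\<in>I. (u has_vector_derivative - tproj (u t) (PB lam e P (u t))) (at t within I))"
    if I: "I \<subseteq> {0..}" and I_dom: "\<And>t. t \<in> I \<Longrightarrow> semi t u0 \<in> dom_gen"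
      and I_cont: "continuous_on I (\<lambda>t. gen (semi t u0))"
      and I_deriv: "\<And>t. t \<in> I \<Longrightarrow>
        ((\<lambda>s. semi s u0) has_vector_derivative - gen (semi t u0)) (at t within I)" for I
  proof -
    have reg: "\<And>t. t \<in> I \<Longrightarrow> flow u0 t \<in> dom_gen" "continuous_on I (\<lambda>t. gen (flow u0 t))"
      "\<And>t. t \<in> I \<Longrightarrow>
        (flow u0 has_vector_derivative - tproj (flow u0 t) (gen (flow u0 t))) (at t within I)"
      by (rule flow_regular[OF u0(1,3) I]; simp add: I_dom I_cont I_deriv)+
    have u_I: "u t = flow u0 t" if "t \<in> I" for t using that I u by auto
    have u_dom: "u t \<in> dom_gen" if "t \<in> I" for t using reg(1) that by (simp add: u_I)
    have gen_u_cont: "continuous_on I (\<lambda>t. gen (u t))"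
    proof (rule continuous_on_eq[OF reg(2)])
      show "gen (flow u0 t) = gen (u t)" if "t \<in> I" for t using u_I[OF that] by simp
    qed
    have u_cont_I: "continuous_on I u" using u_cont I by (rule continuous_on_subset)
    have u_deriv: "(u has_vector_derivative - tproj (u t) (gen (u t))) (at t within I)"
      if "t \<in> I" for t
      using has_vector_derivative_transform[OF that u_I reg(3)[OF that]] u_I[OF that] by simp
    have "((\<lambda>s. graph_norm lam e P (u s - u t)) \<longlongrightarrow> 0) (at t within I)" if "t \<in> I" for t
    proof -
      have "(u \<longlongrightarrow> u t) (at t within I)" "((\<lambda>s. gen (u s)) \<longlongrightarrow> gen (u t)) (at t within I)"
        using u_cont_I gen_u_cont that by (simp_all add: continuous_on_def)
      then have "((\<lambda>s. sqrt ((norm (u s - u t))\<^sup>2 + (norm (gen (u s) - gen (u t)))\<^sup>2))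
          \<longlongrightarrow> sqrt ((norm (u t - u t))\<^sup>2 + (norm (gen (u t) - gen (u t)))\<^sup>2)) (at t within I)"
        by (intro tendsto_intros)
      then have "((\<lambda>s. sqrt ((norm (u s - u t))\<^sup>2 + (norm (gen (u s) - gen (u t)))\<^sup>2))
          \<longlongrightarrow> 0) (at t within I)" by simp
      then show ?thesis
      proof (rule Lim_transform_eventually)
        show "\<forall>\<^sub>F s in at t within I.
            sqrt ((norm (u s - u t))\<^sup>2 + (norm (gen (u s) - gen (u t)))\<^sup>2) = graph_norm lam e P (u s - u t)"
          using u_dom that by (auto simp: eventually_at_filter graph_norm_def PB gen_diff)
      qed
    qed
    then have "u \<in> C_dom I \<Omega> lam e P" using u_dom by (auto simp: C_dom_def dom)
    moreover have "u \<in> C1_H I \<Omega>"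
      unfolding C1_H_def C_H_def
    proof (intro CollectI conjI exI[of _ "\<lambda>t. - tproj (u t) (gen (u t))"] ballI)
      show "u ` I \<subseteq> L2 \<Omega>" using u_H I by auto
      show "(\<lambda>t. - tproj (u t) (gen (u t))) ` I \<subseteq> L2 \<Omega>"
      proof (rule image_subsetI)
        show "- tproj (u t) (gen (u t)) \<in> L2 \<Omega>" if "t \<in> I" for t
          unfolding tproj_def hull[symmetric]
          by (intro subspace_neg[OF subspace_closed_hull] subspace_diff[OF subspace_closed_hull]
              subspace_scale[OF subspace_closed_hull] gen_in_closed_hull dom_gen_closed_hull
              u_dom that)
      qed
      show "continuous_on I (\<lambda>t. - tproj (u t) (gen (u t)))"
        unfolding tproj_def by (intro continuous_intros u_cont_I gen_u_cont)
    qed (rule u_deriv)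
    ultimately show ?thesis using u_deriv by (simp add: PB)
  qed

  have positive: "u \<in> C_dom {0<..} \<Omega> lam e P \<inter> C1_H {0<..} \<Omega> \<and>
      (\<forall>t\<in>{0<..}. (u has_vector_derivative - tproj (u t) (PB lam e P (u t))) (at t within {0<..}))"
  proof (rule regular)
    show "semi t u0 \<in> dom_gen" if "t \<in> {0<..}" for t using that by (simp add: semi_smoothing)
    show "((\<lambda>s. semi s u0) has_vector_derivative - gen (semi t u0)) (at t within {0<..})"
      if "t \<in> {0<..}" for t
      using that by (simp add: has_vector_derivative_at_within semi_has_derivative_positive)
  qed (auto intro: gen_semi_continuous_positive)
  have solves: "solves_flow \<Omega> lam e P u0 u"
    unfolding solves_flow_def
    using positive u_H u_norm u[of 0] flow_0[OF u0(1,2)]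
    by (auto simp: unit_sphere_def at_within_open[of _ "{0<..}"])

  have unique: "v t = u t"
    if v: "v \<in> C_H {0..} \<Omega>" "v \<in> C_dom {0<..} \<Omega> lam e P" "solves_flow \<Omega> lam e P u0 v" and t: "0 \<le> t" for v t
  proof (cases "t = 0")
    case True
    then show ?thesis using v(3) solves by (simp add: solves_flow_def)
  next
    case False
    have v_dom: "v s \<in> dom_gen" if "0 < s" for s
      using v(2) that by (auto simp: C_dom_def dom)
    have "((\<lambda>s. gen (v s)) \<longlongrightarrow> gen (v r)) (at r within {0<..})" if "0 < r" for r
    proof (rule LIM_zero_cancel, rule Lim_null_comparison)
      show "((\<lambda>s. graph_norm lam e P (v s - v r)) \<longlongrightarrow> 0) (at r within {0<..})"
        using v(2) that by (auto simp: C_dom_def)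
      have "norm (gen (v s) - gen (v r)) \<le> graph_norm lam e P (v s - v r)" if "0 < s" for s
        using norm_PB_le_graph_norm[of lam e P "v s - v r"] v_dom \<open>0 < r\<close> that
        by (simp add: PB gen_diff)
      then show "\<forall>\<^sub>F s in at r within {0<..}.
          norm (gen (v s) - gen (v r)) \<le> graph_norm lam e P (v s - v r)"
        by (simp add: eventually_at_filter)
    qed
    then have gen_cont: "continuous_on {0<..} (\<lambda>s. gen (v s))" by (simp add: continuous_on_def)
    have "v t = flow u0 t"
      using v t False
      by (intro flow_unique[OF u0(1,3) _ _ _ _ v_dom gen_cont])
         (auto simp: solves_flow_def unit_sphere_def C_H_def PB hull)
    then show ?thesis using u[OF t] by simp
  qed

  have initial: "u \<in> C_dom {0..} \<Omega> lam e P \<inter> C1_H {0..} \<Omega> \<and>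
      (u has_vector_derivative - tproj (u 0) (PB lam e P (u 0))) (at 0 within {0..})"
    if "u0 \<in> dom_PB \<Omega> lam e P"
  proof -
    have "u0 \<in> dom_gen" using that by (simp add: dom)
    note D = gen_semi[OF this] semi_has_derivative[OF this]
    have "continuous_on {0..} (\<lambda>t. gen (semi t u0))"
      by (rule continuous_on_eq[OF semi_continuous[of "gen u0"]]) (simp add: D)
    with regular[of "{0..}"] D show ?thesis by auto
  qed

  have "u \<in> C_H {0..} \<Omega>" using u_H u_cont by (auto simp: C_H_def)
  with exp_A positive solves unique initial show ?thesis by blast
qed

end
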